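(* Let $d>0$ and let $\alpha$ be a cone angle on $\mathcal{C}_d$. Then every full-dimensional polytope $P\subset\mathbb{R}^d$ satisfies Gram's relation \[ \widehat{\alpha}_0(P)-\widehat{\alpha}_1(P)+\widehat{\alpha}_2(P)-\cdots+(-1)^{d-1}\widehat{\alpha}_{d-1}(P)\;=\;(-1)^{d+1}. \] Moreover, this is the only linear relation up to scaling: if $\lambda_0,\dots,\lambda_{d-1},c\in\mathbb{R}$ are such that $\sum_{i=0}^{d-1}\lambda_i\widehat{\alpha}_i(P)=c$ for every full-dimensional polytope $P\subset\mathbb{R}^d$, then $(\lambda_0,\dots,\lambda_{d-1},c)$ is a scalar multiple of $(1,-1,1,\dots,(-1)^{d-1},(-1)^{d+1})$.
   Context: $\mathcal{C}_d$ denotes the collection of polyhedral cones in $\mathbb{R}^d$ with apex at the origin. A cone angle is a map $\alpha:\mathcal{C}_d\to\mathbb{R}$ such that $\alpha(\{0\})=0$; $\alpha(C\cup C')=\alpha(C)+\alpha(C')-\alpha(C\cap C')$ for all $C,C'\in\mathcal{C}_d$ with $C\cup C',C\cap C'\in\mathcal{C}_d$; $\alpha(C)=0$ whenever $\dim C<d$; and $\alpha(\mathbb{R}^d)=1$ (no rotation invariance or nonnegativity is assumed). For a polytope $P\subset\mathbb{R}^d$, $\mathsf{L}(P)$ is the linear subspace parallel to the affine hull of $P$. For a nonempty face $F$ of $P$ and $q$ in the relative interior of $F$, the tangent cone is $\mathrm{T}_F P=\mathrm{cone}(-q+P)+\mathsf{L}(P)^\perp$ (independent of $q$). The interior angle is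 $\widehat{\alpha}(F,P)=\alpha(\mathrm{T}_FP)$, and for a full-dimensional polytope $P$ and $0\le i\le d-1$, $\widehat{\alpha}_i(P)=\sum_F\widehat{\alpha}(F,P)$, the sum over all faces $F$ of $P$ of dimension $i$. *)

theory Defs
  imports "HOL-Analysis.Analysis"
begin

definition polyhedral_cones :: "'a::euclidean_space set set" where
  "polyhedral_cones = {C. polyhedron C \<and> convex_cone C}"

text \<open>A cone angle is only constrained on polyhedral cones; its values on other sets are junk.\<close>

definition cone_angle :: "('a::euclidean_space set \<Rightarrow> real) \<Rightarrow> bool" where
  "cone_angle \<alpha> \<longleftrightarrow>
     \<alpha> {0} = 0 \<and>
     (\<forall>C\<in>polyhedral_cones. \<forall>C'\<in>polyhedral_cones.
        C \<union> C' \<in> polyhedral_cones \<longrightarrow> C \<inter> C' \<in> polyhedral_cones \<longrightarrow>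
        \<alpha> (C \<union> C') = \<alpha> C + \<alpha> C' - \<alpha> (C \<inter> C')) \<and>
     (\<forall>C\<in>polyhedral_cones. dim C < DIM('a) \<longrightarrow> \<alpha> C = 0) \<and>
     \<alpha> UNIV = 1"

definition parallel_space :: "'a::euclidean_space set \<Rightarrow> 'a set" where
  "parallel_space P = (THE L. subspace L \<and> affine_parallel (affine hull P) L)"

definition tangent_cone_at :: "'a::euclidean_space \<Rightarrow> 'a set \<Rightarrow> 'a set" where
  "tangent_cone_at q P = convex_cone hull ((\<lambda>x. - q + x) ` P) + (parallel_space P)\<^sup>\<bottom>"

text \<open>The choice of the point in the relative interior is immaterial:
  see \<open>tangent_cone_eq\<close> below.\<close>

definition tangent_cone :: "'a::euclidean_space set \<Rightarrow> 'a set \<Rightarrow> 'a set" where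
  "tangent_cone F P = tangent_cone_at (SOME q. q \<in> rel_interior F) P"

definition interior_angle ::
    "('a::euclidean_space set \<Rightarrow> real) \<Rightarrow> 'a set \<Rightarrow> 'a set \<Rightarrow> real" where
  "interior_angle \<alpha> F P = \<alpha> (tangent_cone F P)"

definition angle_sum ::
    "('a::euclidean_space set \<Rightarrow> real) \<Rightarrow> nat \<Rightarrow> 'a set \<Rightarrow> real" where
  "angle_sum \<alpha> i P = (\<Sum>F | F face_of P \<and> aff_dim F = int i. interior_angle \<alpha> F P)"

definition full_dim_polytope :: "'a::euclidean_space set \<Rightarrow> bool" where
  "full_dim_polytope P \<longleftrightarrow> polytope P \<and> aff_dim P = int (DIM('a))"

lemma parallel_space:
  assumes "P \<noteq> {}"
  shows "subspace (parallel_space P)" "affine_parallel (affine hull P) (parallel_space P)"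
  using theI'[OF affine_parallel_subspace[OF affine_affine_hull, of P]] assms
  unfolding parallel_space_def by auto

lemma cone_at_rel_interior_subset:
  fixes P F :: "'a::euclidean_space set"
  assumes P: "convex P" and F: "F face_of P"
    and q: "q \<in> rel_interior F" and q': "q' \<in> rel_interior F"
  shows "convex_cone hull ((\<lambda>x. - q + x) ` P) \<subseteq> convex_cone hull ((\<lambda>x. - q' + x) ` P)"
proof (rule hull_minimal)
  have qF: "q \<in> F" using q rel_interior_subset by blast
  have "convex F" using F face_of_imp_convex by blast
  then obtain e where e: "e > 1" and z: "(1 - e) *\<^sub>R q + e *\<^sub>R q' \<in> F"
    using convex_rel_interior_iff[of F q'] q' qF by blast
  have zP: "(1 - e) *\<^sub>R q + e *\<^sub>R q' \<in> P" using z F face_of_imp_subset by blast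
  show "(\<lambda>x. - q + x) ` P \<subseteq> convex_cone hull ((\<lambda>x. - q' + x) ` P)"
  proof clarify
    fix p assume p: "p \<in> P"
    define r where "r = ((e - 1) / e) *\<^sub>R p + (1 / e) *\<^sub>R ((1 - e) *\<^sub>R q + e *\<^sub>R q')"
    have r: "r \<in> P" unfolding r_def
      by (rule convexD[OF P p zP]) (use e in \<open>auto simp: field_simps\<close>)
    have r': "- q' + r = ((e - 1) / e) *\<^sub>R (- q + p)"
      using e by (simp add: r_def algebra_simps diff_divide_distrib)
    have eq: "- q + p = (e / (e - 1)) *\<^sub>R (- q' + r)"
      unfolding r' using e by simp
    have "- q' + r \<in> convex_cone hull ((\<lambda>x. - q' + x) ` P)"
      using r by (intro hull_inc) blast
    then show "- q + p \<in> convex_cone hull ((\<lambda>x. - q' + x) ` P)"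
      unfolding eq using e
      by (intro convex_cone_scaleR[OF convex_cone_convex_cone_hull]) auto
  qed
qed (rule convex_cone_convex_cone_hull)

lemma tangent_cone_eq:
  assumes "convex P" "F face_of P" "q \<in> rel_interior F"
  shows "tangent_cone F P = tangent_cone_at q P"
proof -
  have "(SOME q. q \<in> rel_interior F) \<in> rel_interior F"
    using assms(3) by (rule someI)
  then show ?thesis
    unfolding tangent_cone_def tangent_cone_at_def
    using cone_at_rel_interior_subset[OF assms(1,2)] assms(3)
    by (metis subset_antisym)
qed

end

theory Submission
  imports Defs
begin

text \<open>
  Write P as a finite intersection of halfspaces. The relative interiors of its faces are the cells
  of the arrangement of bounding hyperplanes that lie in P. Adding a further hyperplane splits each
  crossed cell of dimension k into two cells of dimension k and one of dimension k - 1, so a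
  weighted sum over cells with weights \<open>l\<^sub>k\<close> changes only by the terms
  \<open>l\<^sub>k + l\<^sub>k\<^sub>-\<^sub>1\<close> of the crossed cells.

  Gram's relation: a cone angle of a tangent cone is the sum over the full-dimensional regions of
  the arrangement of facet normals that it contains. For u in the interior of such a region, the
  faces whose tangent cone contains u form a half-open polytope, and its alternating cell count
  vanishes: this count is unchanged by refinement, and after refining by hyperplanes
  parallel to u the cells pair off.

  Uniqueness: set \<open>l\<^sub>d = - c\<close>. Dissecting a polytope by a hyperplane then yields
  \<open>\<Sum> (l\<^sub>k + l\<^sub>k\<^sub>-\<^sub>1) \<alpha>(T\<^sub>F P) = 0\<close>, summed over the crossed faces F with
  k the dimension of F. For the product of a double cone, cut at its equator, with a cube, the
  crossed faces are the products of the double cone with the faces of the cube, and the angles at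
  parallel ones add up to 1. Varying the dimension of the cube gives
  \<open>l\<^sub>k + l\<^sub>k\<^sub>-\<^sub>1 = 0\<close> for all k.
\<close>

subsection \<open>Cells of a hyperplane arrangement\<close>

definition halfspaces_Int :: "('a::euclidean_space \<times> real) set \<Rightarrow> 'a set" where
  "halfspaces_Int A = {x. \<forall>p\<in>A. fst p \<bullet> x \<le> snd p}"

definition side :: "'a::euclidean_space \<times> real \<Rightarrow> 'a \<Rightarrow> real" where
  "side p x = sgn (fst p \<bullet> x - snd p)"

text \<open>The cells are the classes of points with equal sign vectors, each named by any of its
  points. Sums over cells therefore run over images under \<open>cell A\<close>.\<close>

definition cell :: "('a::euclidean_space \<times> real) set \<Rightarrow> 'a \<Rightarrow> 'a set" where
  "cell A x = {y. \<forall>p\<in>A. side p y = side p x}"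

text \<open>For finite \<open>A\<close> this is the linear space parallel to the affine hull of the
  cell.\<close>

definition cell_dir :: "('a::euclidean_space \<times> real) set \<Rightarrow> 'a \<Rightarrow> 'a set" where
  "cell_dir A x = {v. \<forall>p\<in>A. fst p \<bullet> x = snd p \<longrightarrow> fst p \<bullet> v = 0}"

text \<open>Depends on the set \<open>C\<close> alone and not on a chosen point, so that it can
  serve as a weight in sums over cells. On the relative interior of a face of a full-dimensional
  polyhedron it is the tangent cone of that face.\<close>

definition cone_along :: "('a::euclidean_space \<times> real) set \<Rightarrow> 'a set \<Rightarrow> 'a set" where
  "cone_along A C = {u. \<forall>p\<in>A. (\<forall>x\<in>C. fst p \<bullet> x = snd p) \<longrightarrow> fst p \<bullet> u \<le> 0}"

definition crosses :: "'a::euclidean_space \<times> real \<Rightarrow> 'a set \<Rightarrow> bool" where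
  "crosses h C \<longleftrightarrow> (\<exists>y\<in>C. fst h \<bullet> y < snd h) \<and> (\<exists>y\<in>C. fst h \<bullet> y > snd h)"

lemma side_simps:
  "side p x = 0 \<longleftrightarrow> fst p \<bullet> x = snd p"
  "side p x = 1 \<longleftrightarrow> fst p \<bullet> x > snd p"
  "side p x = -1 \<longleftrightarrow> fst p \<bullet> x < snd p"
  "side p x \<le> 0 \<longleftrightarrow> fst p \<bullet> x \<le> snd p"
  by (auto simp: side_def sgn_if)

lemma side_cases: "side p x = -1 \<or> side p x = 0 \<or> side p x = 1"
  by (auto simp: side_def sgn_if)

lemma self_in_cell: "x \<in> cell A x"
  by (simp add: cell_def)

lemma cell_eq_iff: "cell A y = cell A x \<longleftrightarrow> y \<in> cell A x"
  by (auto simp: cell_def)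

lemma cell_insert: "cell (insert h A) x = cell A x \<inter> {y. side h y = side h x}"
  by (auto simp: cell_def)

lemma cell_eqI: "y \<in> cell A x \<Longrightarrow> cell A y = cell A x"
  by (simp add: cell_eq_iff)

lemma tight_cell:
  assumes "y \<in> cell A x" "p \<in> A"
  shows "fst p \<bullet> y = snd p \<longleftrightarrow> fst p \<bullet> x = snd p"
    and "fst p \<bullet> y < snd p \<longleftrightarrow> fst p \<bullet> x < snd p"
    and "fst p \<bullet> y \<le> snd p \<longleftrightarrow> fst p \<bullet> x \<le> snd p"
  using assms side_simps[of p x] side_simps[of p y] by (auto simp: cell_def)

lemma finite_cells:
  assumes "finite A"
  shows "finite (cell A ` U)"
proof -
  \<comment> \<open>A cell is determined by its sign vector, and there are finitely many of
    those.\<close>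
  have "cell A ` U \<subseteq> (\<lambda>s. {y. \<forall>p\<in>A. side p y = s p}) ` (A \<rightarrow>\<^sub>E {-1, 0, 1})"
  proof clarify
    fix x
    have "(\<lambda>p\<in>A. side p x) \<in> A \<rightarrow>\<^sub>E {-1, 0, 1}"
      using side_cases[of _ x] by auto
    moreover have "cell A x = {y. \<forall>p\<in>A. side p y = (\<lambda>p\<in>A. side p x) p}"
      by (auto simp: cell_def)
    ultimately show "cell A x \<in> (\<lambda>s. {y. \<forall>p\<in>A. side p y = s p}) ` (A \<rightarrow>\<^sub>E {-1, 0, 1})"
      by blast
  qed
  then show ?thesis
    using assms by (meson finite.emptyI finite_PiE finite_imageI finite_insert finite_subset)
qed

text \<open>An affine function that is nonzero at \<open>x\<close> needs a positive time to vanish,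
  while one vanishing at \<open>x\<close> immediately takes the sign of its slope; finiteness of
  \<open>A\<close> allows a common time bound.\<close>

lemma side_perturb:
  fixes x v :: "'a::euclidean_space"
  assumes "finite A"
  shows "\<exists>d>0. \<forall>t. 0 < t \<and> t < d \<longrightarrow>
    (\<forall>p\<in>A. side p (x + t *\<^sub>R v) = (if side p x = 0 then sgn (fst p \<bullet> v) else side p x))"
  using assms
proof induction
  case empty
  show ?case by (intro exI[of _ 1]) auto
next
  case (insert p A)
  then obtain d where d: "d > 0" "\<And>t q. \<lbrakk>0 < t; t < d; q \<in> A\<rbrakk> \<Longrightarrow>
     side q (x + t *\<^sub>R v) = (if side q x = 0 then sgn (fst q \<bullet> v) else side q x)"
    by blast
  define e where "e = fst p \<bullet> x - snd p"
  define w where "w = fst p \<bullet> v"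
  have sp: "side p (x + t *\<^sub>R v) = sgn (e + t * w)" for t
    by (simp add: side_def e_def w_def algebra_simps)
  have s0: "side p x = sgn e" by (simp add: side_def e_def)
  have "\<exists>d'>0. \<forall>t. 0 < t \<and> t < d' \<longrightarrow> sgn (e + t * w) = (if e = 0 then sgn w else sgn e)"
  proof (cases "e = 0")
    case True
    then show ?thesis by (intro exI[of _ 1]) (auto simp: sgn_mult)
  next
    case False
    show ?thesis
    \<comment> \<open>The denominator is positive even for \<open>w = 0\<close>, and before this
      time the drift \<open>t * w\<close> stays below \<open>\<bar>e\<bar>\<close> in size.\<close>
    proof (intro exI[of _ "\<bar>e\<bar> / (\<bar>w\<bar> + 1)"] conjI allI impI)
      show "\<bar>e\<bar> / (\<bar>w\<bar> + 1) > 0" using False by (simp add: add_nonneg_pos)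
      fix t assume t: "0 < t \<and> t < \<bar>e\<bar> / (\<bar>w\<bar> + 1)"
      then have "t * (\<bar>w\<bar> + 1) < \<bar>e\<bar>" by (simp add: pos_less_divide_eq add_nonneg_pos)
      then have "\<bar>t * w\<bar> < \<bar>e\<bar>" using t by (simp add: abs_mult algebra_simps)
      then show "sgn (e + t * w) = (if e = 0 then sgn w else sgn e)"
        using False by (auto simp: sgn_if)
    qed
  qed
  then obtain d' where d': "d' > 0"
    "\<And>t. \<lbrakk>0 < t; t < d'\<rbrakk> \<Longrightarrow> sgn (e + t * w) = (if e = 0 then sgn w else sgn e)"
    by blast
  show ?case
    by (rule exI[of _ "min d d'"]) (use d d' in \<open>auto simp: sp s0 w_def[symmetric] sgn_zero_iff\<close>)
qed

text \<open>Cells are relatively open: a direction orthogonal to all tight normals preserves the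
  zero signs, and a short move preserves the other signs.\<close>

lemma cell_perturb:
  fixes x v :: "'a::euclidean_space"
  assumes "finite A" "v \<in> cell_dir A x"
  shows "\<exists>t>0. x + t *\<^sub>R v \<in> cell A x"
proof -
  obtain d where d: "d > 0" "\<And>t p. \<lbrakk>0 < t; t < d; p \<in> A\<rbrakk> \<Longrightarrow>
     side p (x + t *\<^sub>R v) = (if side p x = 0 then sgn (fst p \<bullet> v) else side p x)"
    using side_perturb[OF assms(1)] by meson
  have "x + (d / 2) *\<^sub>R v \<in> cell A x"
    using assms(2) d by (auto simp: cell_def cell_dir_def side_simps)
  then show ?thesis
    using d(1) by (metis half_gt_zero)
qed

lemma subspace_cell_dir: "subspace (cell_dir A x)"
  by (auto simp: cell_dir_def subspace_def inner_add_right)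

lemma diff_in_cell_dir: "y \<in> cell A x \<Longrightarrow> z \<in> cell A x \<Longrightarrow> y - z \<in> cell_dir A x"
proof -
  assume yz: "y \<in> cell A x" "z \<in> cell A x"
  have "fst p \<bullet> y - fst p \<bullet> z = 0" if "p \<in> A" "fst p \<bullet> x = snd p" for p
    using tight_cell(1)[OF yz(1) that(1)] tight_cell(1)[OF yz(2) that(1)] that by linarith
  then show ?thesis by (simp add: cell_dir_def inner_diff_right)
qed

lemma cell_dir_cong: "y \<in> cell A x \<Longrightarrow> cell_dir A y = cell_dir A x"
  unfolding cell_dir_def using tight_cell(1)[of y A x] by blast

lemma aff_dim_cell:
  assumes "finite A"
  shows "aff_dim (cell A x) = int (dim (cell_dir A x))"
proof -
  let ?D = "(\<lambda>y. y - x) ` cell A x"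
  have "aff_dim (cell A x) = int (dim ?D)"
    by (rule aff_dim_eq_dim_subtract) (simp add: hull_inc self_in_cell)
  moreover have "span ?D = cell_dir A x"
  proof
    show "span ?D \<subseteq> cell_dir A x"
      by (intro span_minimal subspace_cell_dir) (auto intro: diff_in_cell_dir self_in_cell)
    \<comment> \<open>Relative openness puts a positive multiple of every such direction among the
      differences of points of the cell.\<close>
    show "cell_dir A x \<subseteq> span ?D"
    proof
      fix v assume "v \<in> cell_dir A x"
      then obtain t where t: "t > 0" "x + t *\<^sub>R v \<in> cell A x"
        using cell_perturb[OF assms] by blast
      then have "t *\<^sub>R v \<in> span ?D"
        by (intro span_base) force
      then have "(1 / t) *\<^sub>R (t *\<^sub>R v) \<in> span ?D"
        by (rule span_scale)
      then show "v \<in> span ?D" using t by simp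
    qed
  qed
  ultimately show ?thesis by (metis dim_span)
qed

section \<open>Cells and an additional hyperplane\<close>

lemma dim_Int_hyperplane:
  fixes V :: "'a::euclidean_space set"
  assumes "subspace V" "v \<in> V" "a \<bullet> v \<noteq> 0"
  shows "int (dim (V \<inter> {x. a \<bullet> x = 0})) = int (dim V) - 1"
proof -
  have "subspace (V \<inter> {x. a \<bullet> x = 0})"
    using assms(1) by (simp add: subspace_inter subspace_hyperplane)
  moreover have "0 \<in> V" using assms(1) by (rule subspace_0)
  then have "V \<inter> {x. a \<bullet> x = 0} \<noteq> {}" by auto
  ultimately show ?thesis
    using aff_dim_affine_Int_hyperplane[OF subspace_imp_affine[OF assms(1)], of a 0] assms
    by (auto simp: aff_dim_subspace)
qed

lemma cell_dir_insert:
  "cell_dir (insert h A) x =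
    (if fst h \<bullet> x = snd h then cell_dir A x \<inter> {v. fst h \<bullet> v = 0} else cell_dir A x)"
  by (auto simp: cell_dir_def)

lemma convex_cell: "convex (cell A x)"
proof -
  have "cell A x = (\<Inter>p\<in>A. {y. side p y = side p x})" by (auto simp: cell_def)
  moreover have "convex {y. side p y = side p x}" for p :: "'a \<times> real"
  proof -
    consider "side p x = -1" | "side p x = 0" | "side p x = 1" using side_cases by blast
    then show ?thesis
    proof cases
      case 1
      show ?thesis unfolding 1 side_simps by (rule convex_halfspace_lt)
    next
      case 2
      show ?thesis unfolding 2 side_simps by (rule convex_hyperplane)
    next
      case 3
      show ?thesis unfolding 3 side_simps by (rule convex_halfspace_gt)
    qed
  qed
  ultimately show ?thesis by (simp add: convex_INT)
qed

lemma crossesI: "\<lbrakk>y \<in> C; side h y = -1; z \<in> C; side h z = 1\<rbrakk> \<Longrightarrow> crosses h C"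
  by (auto simp: crosses_def side_simps)

lemma crosses_cellD:
  assumes "crosses h (cell A x)"
  shows "\<exists>y\<in>cell A x. fst h \<bullet> y = snd h"
proof -
  obtain y z where yz: "y \<in> cell A x" "fst h \<bullet> y < snd h" "z \<in> cell A x" "fst h \<bullet> z > snd h"
    using assms by (auto simp: crosses_def)
  have "connected (cell A x)"
    by (simp add: convex_cell convex_connected)
  then show ?thesis
    using connected_ivt_hyperplane[of "cell A x" y z "fst h" "snd h"] yz by auto
qed

text \<open>If the cell touches the hyperplane at one point and leaves it at another, prolonging the
  segment slightly beyond the touching point stays in the relatively open cell and reaches the other
  side.\<close>

lemma not_crosses_side:
  assumes "finite A" "\<not> crosses h (cell A x)" "y \<in> cell A x" "z \<in> cell A x"
  shows "side h y = side h z"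
proof -
  have key: "side h z = 0" if y: "y \<in> cell A x" and z: "z \<in> cell A x" and "side h y = 0" for y z
  proof (rule ccontr)
    assume nz: "side h z \<noteq> 0"
    have "y - z \<in> cell_dir A y"
      using diff_in_cell_dir[OF y z] cell_dir_cong[OF y] by simp
    then obtain t where t: "t > 0" "y + t *\<^sub>R (y - z) \<in> cell A y"
      using cell_perturb[OF assms(1)] by blast
    let ?w = "y + t *\<^sub>R (y - z)"
    have w: "?w \<in> cell A x" using t cell_eqI[OF y] by simp
    have "fst h \<bullet> ?w - snd h = - t * (fst h \<bullet> z - snd h)"
      using \<open>side h y = 0\<close> by (simp add: side_simps inner_add_right inner_diff_right algebra_simps)
    then have "side h ?w = - side h z"
      using t by (simp add: side_def sgn_mult sgn_minus)
    then have "crosses h (cell A x)"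
      using w z nz side_cases[of h z] crossesI[of z "cell A x" h ?w] crossesI[of ?w "cell A x" h z]
      by (metis minus_minus)
    then show False using assms by simp
  qed
  have "\<not> (side h y = 1 \<and> side h z = -1)" "\<not> (side h z = 1 \<and> side h y = -1)"
    using assms by (auto simp: crosses_def side_simps)
  then show ?thesis
    using key[OF assms(3,4)] key[OF assms(4,3)] side_cases[of h y] side_cases[of h z] by argo
qed

text \<open>The refined cells are grouped by the cell of \<open>A\<close> containing them, and
  \<open>t\<close> is constant on each group. An uncrossed cell survives unchanged; a crossed one of
  dimension k becomes two of dimension k and one of dimension k - 1, a surplus of one term for each
  of the two dimensions.\<close>

lemma sum_cell_insert:
  fixes l :: "int \<Rightarrow> real" and t :: "'a::euclidean_space set \<Rightarrow> real"
  assumes "finite A" and U: "\<And>x. x \<in> U \<Longrightarrow> cell A x \<subseteq> U"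
    and t: "\<And>y. y \<in> U \<Longrightarrow> t (cell (insert h A) y) = t (cell A y)"
  shows "(\<Sum>C\<in>cell (insert h A) ` U. l (aff_dim C) * t C) =
    (\<Sum>C\<in>cell A ` U. l (aff_dim C) * t C) +
    (\<Sum>C | C \<in> cell A ` U \<and> crosses h C. (l (aff_dim C) + l (aff_dim C - 1)) * t C)"
proof -
  let ?B = "insert h A"
  have fB: "finite ?B" using assms(1) by simp
  have split: "cell ?B ` U = (\<Union>C\<in>cell A ` U. cell ?B ` C)"
  proof
    show "(\<Union>C\<in>cell A ` U. cell ?B ` C) \<subseteq> cell ?B ` U" using U by blast
    show "cell ?B ` U \<subseteq> (\<Union>C\<in>cell A ` U. cell ?B ` C)" using self_in_cell[of _ A] by blast
  qed
  have "(\<Sum>C\<in>cell ?B ` U. l (aff_dim C) * t C) =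
      (\<Sum>C\<in>cell A ` U. \<Sum>D\<in>cell ?B ` C. l (aff_dim D) * t D)"
    unfolding split
  proof (rule sum.UNION_disjoint)
    show "\<forall>C\<in>cell A ` U. \<forall>C'\<in>cell A ` U. C \<noteq> C' \<longrightarrow> cell ?B ` C \<inter> cell ?B ` C' = {}"
    proof (intro ballI impI equals0I)
      fix C C' D assume CC: "C \<in> cell A ` U" "C' \<in> cell A ` U" "C \<noteq> C'" "D \<in> cell ?B ` C \<inter> cell ?B ` C'"
      then obtain y z where yz: "y \<in> C" "z \<in> C'" "cell ?B y = cell ?B z" by blast
      then have "y \<in> cell A z" using self_in_cell[of y ?B] by (auto simp: cell_insert)
      moreover have "C = cell A y" "C' = cell A z"
        using CC yz by (auto simp: cell_eqI)
      ultimately show False using CC(3) cell_eqI by blast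
    qed
  qed (simp_all add: finite_cells assms(1))
  also have "\<dots> = (\<Sum>C\<in>cell A ` U. l (aff_dim C) * t C +
      (if crosses h C then (l (aff_dim C) + l (aff_dim C - 1)) * t C else 0))"
  proof (rule sum.cong[OF refl])
    fix C assume "C \<in> cell A ` U"
    then obtain x where x: "x \<in> U" and C: "C = cell A x" by blast
    have tD: "t (cell ?B y) = t C" if "y \<in> C" for y
      using t[of y] that U[OF x] C cell_eqI[of y A x] by (metis subsetD)
    show "(\<Sum>D\<in>cell ?B ` C. l (aff_dim D) * t D) = l (aff_dim C) * t C +
      (if crosses h C then (l (aff_dim C) + l (aff_dim C - 1)) * t C else 0)"
    proof (cases "crosses h C")
      case False
      have "cell ?B y = C" if "y \<in> C" for y
      proof -
        have "side h z = side h y" if "z \<in> C" for z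
          using not_crosses_side[OF assms(1)] False that \<open>y \<in> C\<close> unfolding C by blast
        moreover have "cell A y = C" using that C cell_eqI by blast
        ultimately show ?thesis unfolding cell_insert by blast
      qed
      then have "cell ?B ` C = {C}"
        using C self_in_cell by blast
      then show ?thesis using False by simp
    next
      case True
      then obtain y z w where y: "y \<in> C" "fst h \<bullet> y < snd h" and z: "z \<in> C" "fst h \<bullet> z > snd h"
        and w: "w \<in> C" "fst h \<bullet> w = snd h"
        using crosses_cellD C unfolding crosses_def by blast
      have cB: "cell ?B v = C \<inter> {u. side h u = side h v}" if "v \<in> C" for v
        using that C cell_eqI[of v A x] by (simp add: cell_insert)
      have sy: "side h y = -1" and sz: "side h z = 1" and sw: "side h w = 0"
        using y z w by (simp_all add: side_simps)
      have *: "cell ?B ` C = {cell ?B y, cell ?B z, cell ?B w}"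
      proof
        show "cell ?B ` C \<subseteq> {cell ?B y, cell ?B z, cell ?B w}"
        proof (rule image_subsetI)
          fix v assume "v \<in> C"
          then show "cell ?B v \<in> {cell ?B y, cell ?B z, cell ?B w}"
            using side_cases[of h v] cB[of v] cB[OF y(1)] cB[OF z(1)] cB[OF w(1)] sy sz sw by auto
        qed
      qed (use y z w in auto)
      have dist: "cell ?B y \<noteq> cell ?B z" "cell ?B y \<noteq> cell ?B w" "cell ?B z \<noteq> cell ?B w"
        unfolding cell_eq_iff by (simp_all add: cell_insert sy sz sw)
      have dirC: "cell_dir A v = cell_dir A x" if "v \<in> C" for v
        using cell_dir_cong that C by blast
      \<comment> \<open>The direction \<open>z - y\<close> makes the hyperplane transversal to the
        cell, so the piece on it loses exactly one dimension; the other two pieces acquire no new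
        tight constraint.\<close>
      have "z - y \<in> cell_dir A x" using diff_in_cell_dir y z C by blast
      moreover have "fst h \<bullet> (z - y) \<noteq> 0" using y z by (simp add: inner_diff_right)
      ultimately have "int (dim (cell_dir A x \<inter> {v. fst h \<bullet> v = 0})) = int (dim (cell_dir A x)) - 1"
        using dim_Int_hyperplane[OF subspace_cell_dir] by blast
      then have dims: "aff_dim (cell ?B y) = aff_dim C" "aff_dim (cell ?B z) = aff_dim C"
        "aff_dim (cell ?B w) = aff_dim C - 1"
        using y(2) z(2) w(2) dirC[OF y(1)] dirC[OF z(1)] dirC[OF w(1)]
        unfolding C aff_dim_cell[OF fB] aff_dim_cell[OF assms(1)] cell_dir_insert by simp_all
      show ?thesis
        unfolding * using dist True y z w
        by (simp add: dims tD algebra_simps)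
    qed
  qed
  also have "\<dots> = (\<Sum>C\<in>cell A ` U. l (aff_dim C) * t C) +
    (\<Sum>C\<in>cell A ` U. if crosses h C then (l (aff_dim C) + l (aff_dim C - 1)) * t C else 0)"
    by (rule sum.distrib)
  also have "(\<Sum>C\<in>cell A ` U. if crosses h C then (l (aff_dim C) + l (aff_dim C - 1)) * t C else 0) =
    (\<Sum>C | C \<in> cell A ` U \<and> crosses h C. (l (aff_dim C) + l (aff_dim C - 1)) * t C)"
    by (rule sum.inter_filter[OF finite_cells[OF assms(1)], symmetric])
  finally show ?thesis .
qed

subsection \<open>Faces and tangent cones\<close>

lemma convex_halfspaces_Int: "convex (halfspaces_Int A)"
proof -
  have "halfspaces_Int A = (\<Inter>p\<in>A. {x. fst p \<bullet> x \<le> snd p})"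
    by (auto simp: halfspaces_Int_def)
  then show ?thesis by (simp add: convex_INT convex_halfspace_le)
qed

lemma cell_subset_halfspaces_Int: "x \<in> halfspaces_Int A \<Longrightarrow> cell A x \<subseteq> halfspaces_Int A"
  unfolding halfspaces_Int_def using tight_cell(3)[of _ A x] by blast

text \<open>The face is cut out of the polyhedron by turning the constraints tight at
  \<open>x\<close> into equations; each of them supports the polyhedron.\<close>

lemma face_of_cell:
  fixes x :: "'a::euclidean_space"
  assumes "finite A" and x: "x \<in> halfspaces_Int A"
  obtains F where "F face_of halfspaces_Int A" "rel_interior F = cell A x"
proof -
  define T where "T = {p\<in>A. fst p \<bullet> x = snd p}"
  define F where "F = halfspaces_Int A \<inter> (\<Inter>p\<in>T. {y. fst p \<bullet> y = snd p})"
  have "finite T" using assms(1) by (simp add: T_def)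
  then have "(halfspaces_Int A \<inter> (\<Inter>p\<in>S. {y. fst p \<bullet> y = snd p})) face_of halfspaces_Int A"
    if "S \<subseteq> T" for S
    using that finite_subset[OF that \<open>finite T\<close>]
  proof (induction S rule: infinite_finite_induct)
    case (insert p S)
    have "(halfspaces_Int A \<inter> {y. fst p \<bullet> y = snd p}) face_of halfspaces_Int A"
      using insert.prems by (intro face_of_Int_supporting_hyperplane_le convex_halfspaces_Int)
        (auto simp: halfspaces_Int_def T_def)
    then have "((halfspaces_Int A \<inter> {y. fst p \<bullet> y = snd p}) \<inter>
      (halfspaces_Int A \<inter> (\<Inter>p\<in>S. {y. fst p \<bullet> y = snd p}))) face_of halfspaces_Int A"
      by (rule face_of_Int) (use insert in simp)
    moreover have "(halfspaces_Int A \<inter> {y. fst p \<bullet> y = snd p}) \<inter>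
      (halfspaces_Int A \<inter> (\<Inter>p\<in>S. {y. fst p \<bullet> y = snd p})) =
      halfspaces_Int A \<inter> (\<Inter>p\<in>insert p S. {y. fst p \<bullet> y = snd p})"
      by auto
    ultimately show ?case by (simp only:)
  qed (auto simp: convex_halfspaces_Int face_of_refl)
  then have face: "F face_of halfspaces_Int A" by (simp add: F_def)
  have conv: "convex F" using face face_of_imp_convex by blast
  have xF: "x \<in> F" using x by (auto simp: F_def T_def)
  have cellF: "cell A x \<subseteq> F"
  proof
    fix y assume y: "y \<in> cell A x"
    have "fst p \<bullet> y = snd p" if "p \<in> T" for p
      using tight_cell(1)[OF y, of p] that by (simp add: T_def)
    then show "y \<in> F"
      using cell_subset_halfspaces_Int[OF x] y by (auto simp: F_def)
  qed
  have "rel_interior F = cell A x"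
  proof
    show "cell A x \<subseteq> rel_interior F"
    proof
      fix y assume y: "y \<in> cell A x"
      \<comment> \<open>Criterion for the relative interior: every segment ending at
        \<open>y\<close> can be prolonged inside \<open>F\<close>. The direction
        \<open>y - w\<close> respects all tight constraints, so \<open>cell_perturb\<close>
        applies.\<close>
      have "\<exists>e>1. (1 - e) *\<^sub>R w + e *\<^sub>R y \<in> F" if w: "w \<in> F" for w
      proof -
        have "fst p \<bullet> (y - w) = 0" if p: "p \<in> A" "fst p \<bullet> y = snd p" for p
        proof -
          have "p \<in> T" using tight_cell(1)[OF y p(1)] p by (simp add: T_def)
          then show ?thesis using w p by (simp add: F_def inner_diff_right)
        qed
        then obtain t where t: "t > 0" "y + t *\<^sub>R (y - w) \<in> cell A y"
          using cell_perturb[OF assms(1), of "y - w" y] by (auto simp: cell_dir_def)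
        then have "(1 - (1 + t)) *\<^sub>R w + (1 + t) *\<^sub>R y \<in> F"
          using cellF cell_eqI[OF y] by (auto simp: algebra_simps)
        then show ?thesis using t by (intro exI[of _ "1 + t"]) auto
      qed
      then show "y \<in> rel_interior F"
        using convex_rel_interior_iff[OF conv] xF by blast
    qed
    show "rel_interior F \<subseteq> cell A x"
    proof
      fix z assume z: "z \<in> rel_interior F"
      then have zF: "z \<in> F" using rel_interior_subset by blast
      obtain e where e: "e > 1" "(1 - e) *\<^sub>R x + e *\<^sub>R z \<in> F"
        using convex_rel_interior_iff[OF conv] xF z by blast
      have "side p z = side p x" if p: "p \<in> A" for p
      proof (cases "p \<in> T")
        case True
        then have "fst p \<bullet> z = snd p" "fst p \<bullet> x = snd p" using zF xF by (auto simp: F_def)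
        then show ?thesis by (simp add: side_def)
      next
        case False
        then have lt: "fst p \<bullet> x < snd p" using x p by (force simp: T_def halfspaces_Int_def)
        \<comment> \<open>\<open>z\<close> is a convex combination of \<open>x\<close> and a point
          of \<open>F\<close> with positive weight on \<open>x\<close>, so a constraint slack at
          \<open>x\<close> is slack at \<open>z\<close>.\<close>
        have "fst p \<bullet> ((1 - e) *\<^sub>R x + e *\<^sub>R z) \<le> snd p"
          using e p by (auto simp: F_def halfspaces_Int_def)
        then have "e * (fst p \<bullet> z - snd p) \<le> (e - 1) * (fst p \<bullet> x - snd p)"
          by (simp add: inner_add_right algebra_simps)
        also have "\<dots> < 0" using lt e by (simp add: mult_pos_neg)
        finally have "fst p \<bullet> z < snd p" using e by (simp add: mult_less_0_iff)
        then show ?thesis using lt by (simp add: side_def)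
      qed
      then show "z \<in> cell A x" by (simp add: cell_def)
    qed
  qed
  then show thesis using that face by blast
qed

text \<open>Two faces whose relative interiors meet are equal, and every cell in the polyhedron is
  the relative interior of some face. The empty face is left out because cells are nonempty.\<close>

lemma bij_betw_faces_cells:
  fixes A :: "('a::euclidean_space \<times> real) set"
  assumes "finite A"
  shows "bij_betw rel_interior {F. F face_of halfspaces_Int A \<and> F \<noteq> {}} (cell A ` halfspaces_Int A)"
  unfolding bij_betw_def
proof
  let ?P = "halfspaces_Int A"
  have ne: "rel_interior F \<noteq> {}" if "F face_of ?P" "F \<noteq> {}" for F
    using that face_of_imp_convex rel_interior_eq_empty by blast
  show "inj_on rel_interior {F. F face_of ?P \<and> F \<noteq> {}}"
    using ne face_of_eq by (fastforce intro!: inj_onI)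
  show "rel_interior ` {F. F face_of ?P \<and> F \<noteq> {}} = cell A ` ?P"
  proof
    show "rel_interior ` {F. F face_of ?P \<and> F \<noteq> {}} \<subseteq> cell A ` ?P"
    proof clarify
      fix F assume F: "F face_of ?P" "F \<noteq> {}"
      then obtain x where x: "x \<in> rel_interior F" using ne by blast
      then have xP: "x \<in> ?P" using F face_of_imp_subset rel_interior_subset by blast
      obtain G where "G face_of ?P" "rel_interior G = cell A x"
        using face_of_cell[OF assms xP] by blast
      moreover then have "G = F"
        using F x self_in_cell[of x A] by (intro face_of_eq[of G ?P F]) auto
      ultimately show "rel_interior F \<in> cell A ` ?P" using xP by blast
    qed
    show "cell A ` ?P \<subseteq> rel_interior ` {F. F face_of ?P \<and> F \<noteq> {}}"
    proof (rule image_subsetI)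
      fix x assume x: "x \<in> ?P"
      obtain G where G: "G face_of ?P" "rel_interior G = cell A x"
        using face_of_cell[OF assms x] by blast
      then have "G \<noteq> {}" using self_in_cell[of x A] by auto
      then show "cell A x \<in> rel_interior ` {F. F face_of ?P \<and> F \<noteq> {}}"
        using G by blast
    qed
  qed
qed

section \<open>Tangent cones through tight constraints\<close>

lemma tight_all_cell:
  assumes "p \<in> A" "C \<subseteq> cell A x" "C \<noteq> {}"
  shows "(\<forall>y\<in>C. fst p \<bullet> y = snd p) \<longleftrightarrow> fst p \<bullet> x = snd p"
proof -
  have "fst p \<bullet> y = snd p \<longleftrightarrow> fst p \<bullet> x = snd p" if "y \<in> C" for y
    using tight_cell(1)[OF _ assms(1)] that assms(2) by blast
  then show ?thesis using assms(3) by blast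
qed

text \<open>Allowing nonempty parts \<open>C\<close> of a cell covers the pieces left by a further
  cut, on which the same constraints of \<open>A\<close> are tight.\<close>

lemma cone_along_cell:
  assumes "C \<subseteq> cell A x" "C \<noteq> {}"
  shows "cone_along A C = {u. \<forall>p\<in>A. fst p \<bullet> x = snd p \<longrightarrow> fst p \<bullet> u \<le> 0}"
  unfolding cone_along_def using tight_all_cell[OF _ assms] by blast

lemma parallel_space_full:
  fixes P :: "'a::euclidean_space set"
  assumes "aff_dim P = int (DIM('a))"
  shows "parallel_space P = UNIV"
proof -
  have "affine hull P = UNIV" using assms affine_hull_UNIV aff_dim_eq_full by blast
  moreover have "P \<noteq> {}" using assms by auto
  ultimately have "affine_parallel UNIV (parallel_space P)"
    using parallel_space(2) by metis
  then show ?thesis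
    unfolding affine_parallel_def by (metis surj_plus)
qed

text \<open>Full dimension makes the orthogonal summand of the tangent cone trivial. Constraints
  slack at a point do not restrict the directions leading from it into the polyhedron.\<close>

lemma tangent_cone_eq_cone_along:
  fixes A :: "('a::euclidean_space \<times> real) set"
  assumes "finite A" and full: "aff_dim (halfspaces_Int A) = int (DIM('a))"
    and F: "F face_of halfspaces_Int A" "F \<noteq> {}"
  shows "tangent_cone F (halfspaces_Int A) = cone_along A (rel_interior F)"
proof -
  let ?P = "halfspaces_Int A"
  obtain x where x: "x \<in> ?P" "rel_interior F = cell A x"
    using bij_betw_faces_cells[OF assms(1)] F unfolding bij_betw_def by blast
  have xF: "x \<in> rel_interior F" using x self_in_cell by blast
  have "tangent_cone F ?P = convex_cone hull ((\<lambda>y. - x + y) ` ?P)"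
    by (simp add: tangent_cone_eq[OF convex_halfspaces_Int F(1) xF] tangent_cone_at_def
        parallel_space_full[OF full] set_plus_def)
  also have "\<dots> = {u. \<forall>p\<in>A. fst p \<bullet> x = snd p \<longrightarrow> fst p \<bullet> u \<le> 0}" (is "_ = ?K")
  proof
    have "convex_cone ?K"
      by (auto simp: convex_cone_iff inner_add_right add_nonpos_nonpos mult_nonneg_nonpos)
    moreover have "(\<lambda>y. - x + y) ` ?P \<subseteq> ?K"
      by (auto simp: halfspaces_Int_def inner_diff_right inner_add_right)
    ultimately show "convex_cone hull ((\<lambda>y. - x + y) ` ?P) \<subseteq> ?K"
      by (simp add: hull_minimal)
    show "?K \<subseteq> convex_cone hull ((\<lambda>y. - x + y) ` ?P)"
    proof
      fix u assume u: "u \<in> ?K"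
      \<comment> \<open>A short move along \<open>u\<close> violates no constraint: slack ones stay
        slack and tight ones do not increase.\<close>
      obtain d where d: "d > 0" "\<And>t p. \<lbrakk>0 < t; t < d; p \<in> A\<rbrakk> \<Longrightarrow>
         side p (x + t *\<^sub>R u) = (if side p x = 0 then sgn (fst p \<bullet> u) else side p x)"
        using side_perturb[OF assms(1)] by meson
      define t where "t = d / 2"
      have t: "0 < t" "t < d" using d by (auto simp: t_def)
      have "side p (x + t *\<^sub>R u) \<le> 0" if "p \<in> A" for p
        using d(2)[OF t that] u x(1) that by (auto simp: side_simps halfspaces_Int_def)
      then have "x + t *\<^sub>R u \<in> ?P" by (simp add: side_simps halfspaces_Int_def)
      then have "t *\<^sub>R u \<in> convex_cone hull ((\<lambda>y. - x + y) ` ?P)"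
        by (intro hull_inc) force
      then have "(1 / t) *\<^sub>R (t *\<^sub>R u) \<in> convex_cone hull ((\<lambda>y. - x + y) ` ?P)"
        using t by (intro convex_cone_hull_mul[of "t *\<^sub>R u"]) auto
      then show "u \<in> convex_cone hull ((\<lambda>y. - x + y) ` ?P)" using t by simp
    qed
  qed
  also have "\<dots> = cone_along A (rel_interior F)"
    unfolding x(2) using self_in_cell[of x A] by (intro cone_along_cell[symmetric]) auto
  finally show ?thesis .
qed

text \<open>The improper face has the whole space as tangent cone and contributes \<open>l\<close>
  at the top dimension. A relation with a constant term thus becomes a weighted sum over all
  cells.\<close>

lemma sum_angle_sum_eq:
  fixes A :: "('a::euclidean_space \<times> real) set" and l :: "int \<Rightarrow> real"
  assumes "finite A" and P: "full_dim_polytope (halfspaces_Int A)" and \<alpha>: "\<alpha> UNIV = 1"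
  shows "(\<Sum>C\<in>cell A ` halfspaces_Int A. l (aff_dim C) * \<alpha> (cone_along A C)) =
    (\<Sum>i<DIM('a). l (int i) * angle_sum \<alpha> i (halfspaces_Int A)) + l (int (DIM('a)))"
proof -
  let ?P = "halfspaces_Int A" and ?d = "DIM('a)"
  let ?X = "{F. F face_of ?P \<and> F \<noteq> {}}"
  let ?g = "\<lambda>F. l (aff_dim F) * interior_angle \<alpha> F ?P"
  have full: "aff_dim ?P = int ?d" and poly: "polytope ?P"
    using P by (auto simp: full_dim_polytope_def)
  have fin: "finite {F. F face_of ?P}" using finite_polytope_faces[OF poly] .
  have finX: "finite ?X" by (rule finite_subset[OF _ fin]) auto
  have "(\<Sum>C\<in>cell A ` ?P. l (aff_dim C) * \<alpha> (cone_along A C)) =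
      (\<Sum>F\<in>?X. l (aff_dim (rel_interior F)) * \<alpha> (cone_along A (rel_interior F)))"
    by (rule sum.reindex_bij_betw[OF bij_betw_faces_cells[OF assms(1)], symmetric])
  also have "\<dots> = sum ?g ?X"
  proof (rule sum.cong[OF refl])
    fix F assume F: "F \<in> ?X"
    then have "aff_dim (rel_interior F) = aff_dim F"
      using face_of_imp_convex rel_interior_aff_dim by blast
    then show "l (aff_dim (rel_interior F)) * \<alpha> (cone_along A (rel_interior F)) = ?g F"
      using F tangent_cone_eq_cone_along[OF assms(1) full] by (simp add: interior_angle_def)
  qed
  also have "?X = {F. F face_of ?P \<and> F \<noteq> {} \<and> F \<noteq> ?P} \<union> {?P}" (is "_ = ?Y \<union> _")
    using full by (auto simp: face_of_refl convex_halfspaces_Int)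
  also have "sum ?g (?Y \<union> {?P}) = sum ?g ?Y + ?g ?P"
    using finX by (subst sum.union_disjoint) (auto intro: finite_subset[OF _ fin])
  also have "?g ?P = l (int ?d)"
  proof -
    have ne: "?P \<noteq> {}" using full by auto
    have "interior ?P \<noteq> {}"
      using full aff_dim_eq_full convex_halfspaces_Int[of A] rel_interior_interior rel_interior_eq_empty
        ne by metis
    then obtain x where x: "x \<in> interior ?P" by blast
    then have xr: "x \<in> rel_interior ?P"
      using interior_subset_rel_interior by blast
    have "tangent_cone ?P ?P = convex_cone hull ((\<lambda>y. - x + y) ` ?P)"
      by (simp add: tangent_cone_eq[OF convex_halfspaces_Int face_of_refl xr] convex_halfspaces_Int
          tangent_cone_at_def parallel_space_full[OF full] set_plus_def)
    \<comment> \<open>An interior point allows a short move in every direction.\<close>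
    moreover have "u \<in> convex_cone hull ((\<lambda>y. - x + y) ` ?P)" for u
    proof -
      obtain e where e: "e > 0" "ball x e \<subseteq> ?P" using x mem_interior by blast
      define t where "t = e / (norm u + 1)"
      have t: "t > 0" using e by (simp add: t_def add_nonneg_pos)
      have "t * norm u < e" unfolding t_def using e
        by (simp add: divide_simps add_nonneg_pos)
      then have "x + t *\<^sub>R u \<in> ?P" using e t by (auto simp: dist_norm)
      then have "t *\<^sub>R u \<in> convex_cone hull ((\<lambda>y. - x + y) ` ?P)"
        by (intro hull_inc) force
      then have "(1 / t) *\<^sub>R (t *\<^sub>R u) \<in> convex_cone hull ((\<lambda>y. - x + y) ` ?P)"
        using t by (intro convex_cone_hull_mul[of "t *\<^sub>R u"]) auto
      then show ?thesis using t by simp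
    qed
    ultimately have "tangent_cone ?P ?P = UNIV" by blast
    then show ?thesis using \<alpha> full by (simp add: interior_angle_def)
  qed
  also have "sum ?g ?Y = (\<Sum>i<?d. l (int i) * angle_sum \<alpha> i ?P)"
  proof -
    have Y: "?Y = (\<Union>i\<in>{..<?d}. {F. F face_of ?P \<and> aff_dim F = int i})"
    proof (intro equalityI subsetI)
      fix F assume F: "F \<in> ?Y"
      then have "aff_dim F < int ?d"
        using face_of_aff_dim_lt[OF convex_halfspaces_Int] full by fastforce
      moreover have "0 \<le> aff_dim F" using F aff_dim_negative_iff[of F] by (simp add: not_less[symmetric])
      ultimately show "F \<in> (\<Union>i\<in>{..<?d}. {F. F face_of ?P \<and> aff_dim F = int i})"
        using F by (auto intro!: bexI[of _ "nat (aff_dim F)"])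
    next
      fix F assume "F \<in> (\<Union>i\<in>{..<?d}. {F. F face_of ?P \<and> aff_dim F = int i})"
      then obtain i where "i < ?d" "F face_of ?P" "aff_dim F = int i" by auto
      moreover from this have "F \<noteq> {}" "F \<noteq> ?P" using full by auto
      ultimately show "F \<in> ?Y" by blast
    qed
    show ?thesis unfolding Y angle_sum_def sum_distrib_left
      by (subst sum.UNION_disjoint) (auto intro!: sum.cong finite_subset[OF _ fin])
  qed
  finally show ?thesis .
qed

subsection \<open>Alternating cell counts\<close>

text \<open>\<open>(-1)^k\<close> for integers \<open>k\<close>, because \<open>aff_dim\<close> is
  integer-valued.\<close>

definition isign :: "int \<Rightarrow> real" where
  "isign k = (if even k then 1 else -1)"

lemma isign_of_nat: "isign (int i) = (-1) ^ i"
  by (simp add: isign_def)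

lemma isign_pred: "isign k + isign (k - 1) = 0"
  by (simp add: isign_def)

text \<open>Consecutive weights cancel, so every crossed cell contributes 0 to the change in
  \<open>sum_cell_insert\<close>.\<close>

lemma sum_isign_refine:
  assumes "finite G" "finite A" and U: "\<And>x. x \<in> U \<Longrightarrow> cell A x \<subseteq> U"
  shows "(\<Sum>C\<in>cell (G \<union> A) ` U. isign (aff_dim C)) = (\<Sum>C\<in>cell A ` U. isign (aff_dim C))"
  using assms(1)
proof induction
  case (insert g G)
  have "cell (G \<union> A) x \<subseteq> U" if "x \<in> U" for x
    using U[OF that] by (auto simp: cell_def)
  then have "(\<Sum>C\<in>cell (insert g (G \<union> A)) ` U. isign (aff_dim C) * 1) =
    (\<Sum>C\<in>cell (G \<union> A) ` U. isign (aff_dim C) * 1) +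
    (\<Sum>C | C \<in> cell (G \<union> A) ` U \<and> crosses g C. (isign (aff_dim C) + isign (aff_dim C - 1)) * 1)"
    using insert.hyps assms(2) by (intro sum_cell_insert[where t = "\<lambda>_. 1"]) auto
  then show ?case using insert.IH by (simp add: isign_pred)
qed simp

text \<open>The half-open polytope U consists of the points of P from which one can move a little in
  direction u without leaving P. After refining by the hyperplanes parallel to u through all
  pairwise intersections, the cells in U lying in some facet hyperplane are matched with the cells
  immediately above them, whose dimension is one larger.\<close>

lemma sum_isign_half_open:
  fixes A :: "('a::euclidean_space \<times> real) set"
  assumes fin: "finite A" and bdd: "bounded (halfspaces_Int A)"
    and gen: "\<And>p. p \<in> A \<Longrightarrow> fst p \<bullet> u \<noteq> 0"
    and U: "U = {x \<in> halfspaces_Int A. \<forall>p\<in>A. fst p \<bullet> x = snd p \<longrightarrow> fst p \<bullet> u < 0}"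
  shows "(\<Sum>C\<in>cell A ` U. isign (aff_dim C)) = 0"
proof (cases "U = {}")
  case False
  then obtain x0 where x0: "x0 \<in> halfspaces_Int A" using U by blast
  \<comment> \<open>Otherwise every constraint increases along \<open>u\<close>, and the polyhedron
    contains the whole ray from \<open>x0\<close> in direction \<open>- u\<close>, against
    boundedness.\<close>
  have ex_lower: "\<exists>p\<in>A. fst p \<bullet> u < 0"
  proof (rule ccontr)
    assume "\<not> ?thesis"
    then have pos: "fst p \<bullet> u > 0" if "p \<in> A" for p using gen[OF that] that by force
    obtain K where K: "\<And>x. x \<in> halfspaces_Int A \<Longrightarrow> norm x \<le> K"
      using bdd unfolding bounded_iff by blast
    have *: "x0 - t *\<^sub>R u \<in> halfspaces_Int A" if "t \<ge> 0" for t
      unfolding halfspaces_Int_def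
    proof clarify
      fix a b assume p: "(a, b) \<in> A"
      have "a \<bullet> x0 \<le> b" using x0 p by (force simp: halfspaces_Int_def)
      moreover have "t * (a \<bullet> u) \<ge> 0" using pos[OF p] that by simp
      ultimately show "fst (a, b) \<bullet> (x0 - t *\<^sub>R u) \<le> snd (a, b)" by (simp add: inner_diff_right)
    qed
    show False
    proof (cases "u = 0")
      case True
      then have "A = {}" using gen by auto
      then have "halfspaces_Int A = UNIV" by (auto simp: halfspaces_Int_def)
      then show False using bdd not_bounded_UNIV by metis
    next
      case False
      \<comment> \<open>Long enough to carry \<open>x0 - t *\<^sub>R u\<close> out of the ball of
        radius \<open>K\<close>.\<close>
      define t where "t = (K + norm x0 + 1) / norm u"
      have "0 \<le> K" using K[OF x0] norm_ge_zero order_trans by blast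
      then have "t \<ge> 0" by (simp add: t_def)
      then have "norm (x0 - t *\<^sub>R u) \<le> K" using * K by blast
      moreover have "norm (t *\<^sub>R u) = K + norm x0 + 1"
        using False \<open>0 \<le> K\<close> by (simp add: t_def)
      ultimately show False
        using norm_triangle_ineq2[of "t *\<^sub>R u" x0] by (simp add: norm_minus_commute)
    qed
  qed
  \<comment> \<open>\<open>F p z\<close> is the height of \<open>z\<close> above the hyperplane of
    \<open>p\<close>, measured along \<open>u\<close>: it grows at unit speed in direction
    \<open>u\<close>. The pair \<open>g p q\<close> encodes the affine function
    \<open>F p - F q\<close>, which is constant along \<open>u\<close> and vanishes where the
    hyperplanes of \<open>p\<close> and \<open>q\<close> meet.\<close>
  define F where "F p z = (fst p \<bullet> z - snd p) / (fst p \<bullet> u)" for p :: "'a \<times> real" and z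
  define g where "g p q = ((1 / (fst p \<bullet> u)) *\<^sub>R fst p - (1 / (fst q \<bullet> u)) *\<^sub>R fst q,
      snd p / (fst p \<bullet> u) - snd q / (fst q \<bullet> u))" for p q :: "'a \<times> real"
  define G where "G = (\<lambda>(p, q). g p q) ` (A \<times> A)"
  define B where "B = G \<union> A"
  \<comment> \<open>The side of \<open>p\<close> reached just after leaving \<open>y\<close> in
    direction \<open>u\<close>.\<close>
  define s where "s p y = (if side p y = 0 then sgn (fst p \<bullet> u) else side p y)" for p y
  have finG: "finite G" and finB: "finite B" using fin by (auto simp: G_def B_def)
  have F_add: "F p (z + t *\<^sub>R u) = F p z + t" if "p \<in> A" for p z t
    using gen[OF that] by (simp add: F_def inner_add_right field_simps)
  have fF: "fst p \<bullet> z - snd p = F p z * (fst p \<bullet> u)" if "p \<in> A" for p z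
    using gen[OF that] by (simp add: F_def)
  have sideF: "side p z = sgn (F p z) * sgn (fst p \<bullet> u)" if "p \<in> A" for p z
    using fF[OF that] by (simp add: side_def sgn_mult)
  have side0: "side p z = 0 \<longleftrightarrow> F p z = 0" if "p \<in> A" for p z
    using gen[OF that] by (simp add: sideF[OF that] sgn_zero_iff)
  have side_g: "side (g p q) z = sgn (F p z - F q z)" for p q z
    by (simp add: side_def g_def F_def inner_diff_left diff_divide_distrib)
       (simp add: algebra_simps)
  have g_u: "fst h \<bullet> u = 0" if "h \<in> G" for h
    using that gen by (auto simp: G_def g_def inner_diff_left)
  have gG: "g p q \<in> G" if "p \<in> A" "q \<in> A" for p q
    using that by (auto simp: G_def)
  have s_A: "s p y = (if F p y \<ge> 0 then 1 else -1) * sgn (fst p \<bullet> u)" if "p \<in> A" for p y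
    by (simp add: s_def side0[OF that]) (simp add: sideF[OF that])
  have s_G: "s h y = side h y" if "h \<in> G" for h y
    using g_u[OF that] by (simp add: s_def)
  \<comment> \<open>Membership in \<open>U\<close> only asks which heights are nonnegative: lower
    constraints (\<open>fst p \<bullet> u < 0\<close>) are closed, upper ones open.\<close>
  have U_iff: "y \<in> U \<longleftrightarrow> (\<forall>p\<in>A. if fst p \<bullet> u < 0 then F p y \<ge> 0 else F p y < 0)" for y
  proof -
    have "(fst p \<bullet> y \<le> snd p \<and> (fst p \<bullet> y = snd p \<longrightarrow> fst p \<bullet> u < 0)) \<longleftrightarrow>
        (if fst p \<bullet> u < 0 then F p y \<ge> 0 else F p y < 0)" if "p \<in> A" for p
      using gen[OF that] by (auto simp: F_def divide_simps)
    then show ?thesis unfolding U halfspaces_Int_def by blast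
  qed
  have UA: "cell A x \<subseteq> U" if "x \<in> U" for x
  proof
    fix y assume y: "y \<in> cell A x"
    have "sgn (F p y) = sgn (F p x)" if "p \<in> A" for p
      using y that gen[OF that] by (auto simp: cell_def sideF sgn_zero_iff)
    then have "(F p y \<ge> 0) = (F p x \<ge> 0)" if "p \<in> A" for p
      using that by (metis sgn_less not_less)
    then show "y \<in> U" using \<open>x \<in> U\<close> unfolding U_iff by (metis not_less)
  qed
  \<comment> \<open>Points on some hyperplane of \<open>A\<close> and points on none; the cells of
    the first kind will be matched with those of the second.\<close>
  define U0 where "U0 = {x \<in> U. \<exists>p\<in>A. F p x = 0}"
  define U1 where "U1 = {x \<in> U. \<forall>p\<in>A. F p x \<noteq> 0}"
  have "\<exists>z\<in>U1. \<forall>p\<in>B. side p z = s p y" if y: "y \<in> U0" for y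
  proof -
    obtain d where d: "d > 0" "\<And>t p. \<lbrakk>0 < t; t < d; p \<in> B\<rbrakk> \<Longrightarrow> side p (y + t *\<^sub>R u) = s p y"
      using side_perturb[OF finB, of y u] unfolding s_def by meson
    define z where "z = y + (d / 2) *\<^sub>R u"
    have z: "side p z = s p y" if "p \<in> B" for p
      using d that by (simp add: z_def)
    have "F p z \<noteq> 0 \<and> (F p z \<ge> 0 \<longleftrightarrow> F p y \<ge> 0)" if "p \<in> A" for p
    proof -
      have "sgn (F p z) = (if F p y \<ge> 0 then 1 else -1)"
        using z[of p] that gen[OF that] by (simp add: B_def sideF s_A sgn_zero_iff)
      then show ?thesis by (auto simp: sgn_if split: if_splits)
    qed
    then have "z \<in> U1" using y unfolding U0_def U1_def mem_Collect_eq U_iff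
      by (metis not_less)
    then show ?thesis using z by blast
  qed
  then obtain up where up: "\<And>y. y \<in> U0 \<Longrightarrow> up y \<in> U1"
    "\<And>y p. y \<in> U0 \<Longrightarrow> p \<in> B \<Longrightarrow> side p (up y) = s p y"
    by metis
  \<comment> \<open>The matching, written on sets so that it is independent of the point naming a
    cell.\<close>
  define h where "h C = {z. \<exists>y\<in>C. \<forall>p\<in>B. side p z = s p y}" for C
  have h: "h (cell B y) = cell B (up y)" if "y \<in> U0" for y
  proof -
    have "s p y' = s p y" if "y' \<in> cell B y" "p \<in> B" for p y'
      using that by (simp add: cell_def s_def)
    then have "h (cell B y) = {z. \<forall>p\<in>B. side p z = s p y}"
      unfolding h_def using self_in_cell[of y B] by (intro Collect_cong) (metis (no_types, lifting))
    also have "\<dots> = cell B (up y)"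
      unfolding cell_def using up(2)[OF that] by (intro Collect_cong) simp
    finally show ?thesis .
  qed
  have bij: "bij_betw h (cell B ` U0) (cell B ` U1)"
    unfolding bij_betw_def
  proof
    show "inj_on h (cell B ` U0)"
    proof (rule inj_onI, clarify)
      fix y y' assume y: "y \<in> U0" and y': "y' \<in> U0" and "h (cell B y) = h (cell B y')"
      then have "cell B (up y) = cell B (up y')" by (simp add: h)
      then have "up y \<in> cell B (up y')" by (simp add: cell_eq_iff)
      then have ss: "s p y = s p y'" if "p \<in> B" for p
        using that up(2)[OF y that] up(2)[OF y' that] by (simp add: cell_def)
      have nn: "F p y \<ge> 0 \<longleftrightarrow> F p y' \<ge> 0" if "p \<in> A" for p
        using ss[of p] that gen[OF that] by (auto simp: B_def s_A sgn_zero_iff split: if_splits)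
      have gg: "sgn (F p y - F q y) = sgn (F p y' - F q y')" if "p \<in> A" "q \<in> A" for p q
        using ss[of "g p q"] gG[OF that] by (simp add: B_def s_G side_g)
      \<comment> \<open>With \<open>i\<close> tight at \<open>y\<close> and \<open>k\<close> tight
        at \<open>y'\<close>, the height difference \<open>F i - F k\<close> is at most 0 at
        \<open>y\<close> and at least 0 at \<open>y'\<close>. \<open>G\<close> records its sign,
        which agrees at both points, so it is 0 and \<open>i\<close> is tight at \<open>y'\<close>
        too. All other signs follow by comparing heights with that of \<open>i\<close>.\<close>
      obtain i k where i: "i \<in> A" "F i y = 0" and k: "k \<in> A" "F k y' = 0"
        using y y' unfolding U0_def by blast
      have "F i y' \<ge> 0" "F k y \<ge> 0" using nn[OF i(1)] nn[OF k(1)] i k by simp_all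
      moreover have "sgn (- F k y) = sgn (F i y')" using gg[OF i(1) k(1)] i k by simp
      ultimately have "F i y' = 0" by (auto simp: sgn_if split: if_splits)
      then have "sgn (F p y) = sgn (F p y')" if "p \<in> A" for p
        using gg[OF that i(1)] i by simp
      then have "side p y = side p y'" if "p \<in> A" for p
        using that by (simp add: sideF)
      moreover have "side p y = side p y'" if "p \<in> G" for p
        using ss[of p] that by (simp add: B_def s_G)
      ultimately show "cell B y = cell B y'"
        unfolding cell_eq_iff by (auto simp: B_def cell_def)
    qed
    show "h ` cell B ` U0 = cell B ` U1"
    proof (intro equalityI subsetI)
      fix D assume "D \<in> h ` cell B ` U0"
      then show "D \<in> cell B ` U1" using h up(1) by auto
    next
      fix D assume "D \<in> cell B ` U1"
      then obtain x where x: "x \<in> U1" and D: "D = cell B x" by blast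
      \<comment> \<open>Descend from \<open>x\<close> against \<open>u\<close> until the first
        hyperplane of \<open>A\<close> is met: \<open>t\<close> is the least positive height, and
        \<open>ex_lower\<close> ensures that there is one.\<close>
      define M where "M = {r \<in> (\<lambda>p. F p x) ` A. r > 0}"
      have finM: "finite M" using fin by (simp add: M_def)
      have neM: "M \<noteq> {}"
      proof -
        obtain p where p: "p \<in> A" "fst p \<bullet> u < 0" using ex_lower by blast
        then have "F p x \<ge> 0" "F p x \<noteq> 0" using x unfolding U1_def U_iff by auto
        then have "F p x \<in> M" using p by (simp add: M_def)
        then show ?thesis by blast
      qed
      define t where "t = Min M"
      define y where "y = x - t *\<^sub>R u"
      have "t \<in> M" using Min_in[OF finM neM] by (simp add: t_def)
      then obtain q where q: "q \<in> A" "F q x = t" "t > 0" unfolding M_def by blast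
      have Fy: "F p y = F p x - t" if "p \<in> A" for p
        using F_add[OF that, of x "- t"] by (simp add: y_def)
      have sgnF: "F p y \<ge> 0 \<longleftrightarrow> F p x > 0" if "p \<in> A" for p
      proof
        assume "F p x > 0"
        then have "F p x \<in> M" using that by (simp add: M_def)
        then have "t \<le> F p x" using finM by (simp add: t_def)
        then show "F p y \<ge> 0" using Fy[OF that] by simp
      qed (use Fy[OF that] q in simp)
      have nz: "F p x \<noteq> 0" if "p \<in> A" for p using x that by (simp add: U1_def)
      have "y \<in> U"
        unfolding U_iff
      proof
        fix p assume p: "p \<in> A"
        have "if fst p \<bullet> u < 0 then F p x \<ge> 0 else F p x < 0"
          using x p unfolding U1_def U_iff by blast
        then show "if fst p \<bullet> u < 0 then F p y \<ge> 0 else F p y < 0"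
          using sgnF[OF p] nz[OF p] by (auto split: if_splits)
      qed
      then have yU: "y \<in> U0" using q Fy[OF q(1)] by (auto simp: U0_def)
      have "side p (up y) = side p x" if "p \<in> B" for p
      proof (cases "p \<in> A")
        case True
        then show ?thesis
          using up(2)[OF yU that] sgnF[OF True] nz[OF True] True by (auto simp: s_A sideF sgn_if)
      next
        case False
        then have "p \<in> G" using that by (simp add: B_def)
        then show ?thesis
          using up(2)[OF yU that] g_u[of p] by (simp add: s_G side_def y_def inner_diff_right)
      qed
      then have "cell B (up y) = D" unfolding D cell_eq_iff by (simp add: cell_def)
      then show "D \<in> h ` cell B ` U0" using h[OF yU] yU by blast
    qed
  qed
  have dim: "aff_dim (cell B (up y)) = aff_dim (cell B y) + 1" if y: "y \<in> U0" for y
  proof -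
    obtain i where i: "i \<in> A" "F i y = 0" using y unfolding U0_def by blast
    have tightA: "fst p \<bullet> z = snd p \<longleftrightarrow> F p z = 0" if "p \<in> A" for p z
      using side0[OF that] side_simps(1) by blast
    have up_A: "fst p \<bullet> up y \<noteq> snd p" if "p \<in> A" for p
      using up(1)[OF y] that by (simp add: U1_def tightA)
    have up_G: "fst p \<bullet> up y = snd p \<longleftrightarrow> fst p \<bullet> y = snd p" if "p \<in> G" for p
      using up(2)[OF y, of p] that s_G[OF that] side_simps(1) by (metis B_def UnI1)
    have V: "cell_dir B (up y) = {v. \<forall>p\<in>G. fst p \<bullet> y = snd p \<longrightarrow> fst p \<bullet> v = 0}"
      using up_A up_G unfolding cell_dir_def B_def by blast
    have "fst p \<bullet> v = 0" if v: "v \<in> cell_dir B (up y)" "fst i \<bullet> v = 0"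
      and p: "p \<in> A" "fst p \<bullet> y = snd p" for p v
    proof -
      have "side (g p i) y = 0" using i p tightA by (simp add: side_g)
      then have "fst (g p i) \<bullet> v = 0"
        using v gG[OF p(1) i(1)] unfolding V side_simps by blast
      then show ?thesis using v gen[OF p(1)] by (simp add: g_def inner_diff_left)
    qed
    \<comment> \<open>Above \<open>y\<close> only hyperplanes of \<open>G\<close> are tight. Adding
      the equation of \<open>i\<close> recovers the equations of all constraints tight at
      \<open>y\<close>; since \<open>u\<close> satisfies the former but not the latter, exactly one
      dimension is lost.\<close>
    then have "cell_dir B y = cell_dir B (up y) \<inter> {v. fst i \<bullet> v = 0}"
      using i tightA[OF i(1)] V unfolding cell_dir_def B_def by blast
    moreover have "u \<in> cell_dir B (up y)" using g_u by (simp add: V)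
    ultimately show ?thesis
      using dim_Int_hyperplane[OF subspace_cell_dir, of u B "up y" "fst i"] gen[OF i(1)]
      by (simp add: aff_dim_cell[OF finB])
  qed
  have "(\<Sum>C\<in>cell A ` U. isign (aff_dim C)) = (\<Sum>C\<in>cell B ` U. isign (aff_dim C))"
    unfolding B_def using sum_isign_refine[OF finG fin, of U] UA by simp
  also have "cell B ` U = cell B ` U0 \<union> cell B ` U1"
  proof -
    have "U = U0 \<union> U1" unfolding U0_def U1_def by blast
    then show ?thesis by (simp only: image_Un)
  qed
  also have "(\<Sum>C\<in>cell B ` U0 \<union> cell B ` U1. isign (aff_dim C)) =
     (\<Sum>C\<in>cell B ` U0. isign (aff_dim C)) + (\<Sum>C\<in>cell B ` U1. isign (aff_dim C))"
  proof (rule sum.union_disjoint)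
    show "cell B ` U0 \<inter> cell B ` U1 = {}"
    proof (rule equals0I)
      fix C assume "C \<in> cell B ` U0 \<inter> cell B ` U1"
      then obtain y z where yz: "y \<in> U0" "z \<in> U1" "cell B y = cell B z" by blast
      then have "y \<in> cell B z" using cell_eq_iff by blast
      moreover obtain p where p: "p \<in> A" "F p y = 0" using yz unfolding U0_def by blast
      ultimately have "side p y = side p z" by (simp add: cell_def B_def)
      then have "F p z = 0" using p side0[OF p(1), of y] side0[OF p(1), of z] by simp
      then show False using yz p by (simp add: U1_def)
    qed
  qed (auto intro: finite_cells finB)
  also have "(\<Sum>C\<in>cell B ` U1. isign (aff_dim C)) = (\<Sum>C\<in>cell B ` U0. isign (aff_dim (h C)))"
    by (rule sum.reindex_bij_betw[OF bij, symmetric])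
  also have "\<dots> = (\<Sum>C\<in>cell B ` U0. - isign (aff_dim C))"
    by (rule sum.cong) (auto simp: h dim isign_def)
  finally show ?thesis by (simp add: sum_negf)
qed simp

subsection \<open>Cone angles and dissections\<close>

text \<open>For \<open>T \<subseteq> N\<close> these are the closed chambers of the central
  arrangement with normals \<open>N\<close>. If the normals are nonzero, sign patterns without a
  strict solution give lower-dimensional cones, of angle 0.\<close>

definition region :: "'a::euclidean_space set \<Rightarrow> 'a set \<Rightarrow> 'a set" where
  "region N T = {u. (\<forall>a\<in>T. a \<bullet> u \<le> 0) \<and> (\<forall>a\<in>N - T. a \<bullet> u \<ge> 0)}"

lemma polyhedral_cone_Int:
  "\<lbrakk>C \<in> polyhedral_cones; D \<in> polyhedral_cones\<rbrakk> \<Longrightarrow> C \<inter> D \<in> polyhedral_cones"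
  by (auto simp: polyhedral_cones_def convex_cone_iff)

lemma polyhedral_cone_halfspaces:
  "{u. a \<bullet> u \<le> 0} \<in> polyhedral_cones" "{u. a \<bullet> u \<ge> 0} \<in> polyhedral_cones"
  by (simp_all add: polyhedral_cones_def polyhedron_halfspace_le polyhedron_halfspace_ge
      convex_cone_halfspace_le convex_cone_halfspace_ge)

lemma polyhedral_cone_UNIV: "UNIV \<in> polyhedral_cones"
  by (simp add: polyhedral_cones_def convex_cone_iff)

lemma polyhedral_cone_INT_le:
  assumes "finite N"
  shows "{u. \<forall>a\<in>N. a \<bullet> u \<le> 0} \<in> polyhedral_cones"
  using assms
proof induction
  case (insert a N)
  have "{u. \<forall>b\<in>insert a N. b \<bullet> u \<le> 0} = {u. a \<bullet> u \<le> 0} \<inter> {u. \<forall>b\<in>N. b \<bullet> u \<le> 0}" by auto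
  then show ?case using insert by (simp add: polyhedral_cone_Int polyhedral_cone_halfspaces)
qed (simp add: polyhedral_cone_UNIV)

lemma polyhedral_cone_region:
  assumes "finite N" "T \<subseteq> N"
  shows "region N T \<in> polyhedral_cones"
proof -
  have "region N T = {u. \<forall>a\<in>T \<union> uminus ` (N - T). a \<bullet> u \<le> 0}"
    unfolding region_def ball_Un ball_simps inner_minus_left neg_le_0_iff_le by simp
  then show ?thesis
    using polyhedral_cone_INT_le[of "T \<union> uminus ` (N - T)"] assms finite_subset[OF assms(2,1)] by simp
qed

lemma polyhedral_cone_along:
  assumes "finite A"
  shows "cone_along A C \<in> polyhedral_cones"
proof -
  have "cone_along A C = {u. \<forall>a\<in>fst ` {p\<in>A. \<forall>x\<in>C. fst p \<bullet> x = snd p}. a \<bullet> u \<le> 0}"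
    unfolding cone_along_def by blast
  then show ?thesis
    using polyhedral_cone_INT_le[of "fst ` {p\<in>A. \<forall>x\<in>C. fst p \<bullet> x = snd p}"] assms by simp
qed

lemma cone_angle_null:
  fixes \<alpha> :: "'a::euclidean_space set \<Rightarrow> real"
  assumes "cone_angle \<alpha>" "C \<in> polyhedral_cones" "C \<subseteq> {u. a \<bullet> u = 0}" "a \<noteq> 0"
  shows "\<alpha> C = 0"
proof -
  have "dim C \<le> dim {u. a \<bullet> u = 0}" using assms(3) by (rule dim_subset)
  also have "\<dots> = DIM('a) - 1" using assms(4) by (rule dim_hyperplane)
  also have "\<dots> < DIM('a)" by simp
  finally show ?thesis using assms(1,2) by (simp add: cone_angle_def)
qed

text \<open>The two halves overlap inside a hyperplane, where the angle vanishes; hence the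
  valuation property becomes plain additivity.\<close>

lemma cone_angle_cut:
  assumes \<alpha>: "cone_angle \<alpha>" and C: "C \<in> polyhedral_cones" and "a \<noteq> 0"
  shows "\<alpha> C = \<alpha> (C \<inter> {u. a \<bullet> u \<le> 0}) + \<alpha> (C \<inter> {u. a \<bullet> u \<ge> 0})"
proof -
  let ?L = "C \<inter> {u. a \<bullet> u \<le> 0}" and ?R = "C \<inter> {u. a \<bullet> u \<ge> 0}"
  have pc: "?L \<in> polyhedral_cones" "?R \<in> polyhedral_cones" "?L \<inter> ?R \<in> polyhedral_cones"
    using C by (simp_all add: polyhedral_cone_Int polyhedral_cone_halfspaces)
  have un: "?L \<union> ?R = C" by auto
  then have "\<alpha> (?L \<union> ?R) = \<alpha> ?L + \<alpha> ?R - \<alpha> (?L \<inter> ?R)"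
    using \<alpha> pc C unfolding cone_angle_def by metis
  moreover have "\<alpha> (?L \<inter> ?R) = 0"
    by (rule cone_angle_null[OF \<alpha> pc(3) _ assms(3)]) auto
  ultimately show ?thesis using un by simp
qed

text \<open>Induction on the normals, cutting every region by one more: subsets that gain the new
  normal take its nonpositive side, the others its nonnegative side.\<close>

lemma cone_angle_regions:
  assumes \<alpha>: "cone_angle \<alpha>" and "finite N" "0 \<notin> N" and C: "C \<in> polyhedral_cones"
  shows "\<alpha> C = (\<Sum>T\<in>Pow N. \<alpha> (C \<inter> region N T))"
  using assms(2,3)
proof induction
  case (insert a N)
  have disj: "Pow N \<inter> insert a ` Pow N = {}" using insert.hyps by auto
  have inj: "inj_on (insert a) (Pow N)"
    using insert.hyps by (auto simp: inj_on_def)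
  have reg: "region (insert a N) T = region N T \<inter> {u. a \<bullet> u \<ge> 0}"
      "region (insert a N) (insert a T) = region N T \<inter> {u. a \<bullet> u \<le> 0}" if "T \<subseteq> N" for T
    using that insert.hyps by (auto simp: region_def)
  have "(\<Sum>T\<in>Pow (insert a N). \<alpha> (C \<inter> region (insert a N) T)) =
     (\<Sum>T\<in>Pow N. \<alpha> (C \<inter> region (insert a N) T)) +
     (\<Sum>T\<in>Pow N. \<alpha> (C \<inter> region (insert a N) (insert a T)))"
    unfolding Pow_insert using insert.hyps disj
    by (subst sum.union_disjoint) (simp_all add: sum.reindex[OF inj])
  also have "\<dots> = (\<Sum>T\<in>Pow N. \<alpha> (C \<inter> region N T \<inter> {u. a \<bullet> u \<le> 0}) + \<alpha> (C \<inter> region N T \<inter> {u. a \<bullet> u \<ge> 0}))"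
    unfolding sum.distrib[symmetric] by (rule sum.cong) (auto simp: reg Int_assoc)
  also have "\<dots> = (\<Sum>T\<in>Pow N. \<alpha> (C \<inter> region N T))"
  proof (rule sum.cong[OF refl])
    fix T assume "T \<in> Pow N"
    then have "C \<inter> region N T \<in> polyhedral_cones"
      using C insert.hyps by (auto intro: polyhedral_cone_Int polyhedral_cone_region)
    then show "\<alpha> (C \<inter> region N T \<inter> {u. a \<bullet> u \<le> 0}) + \<alpha> (C \<inter> region N T \<inter> {u. a \<bullet> u \<ge> 0}) =
        \<alpha> (C \<inter> region N T)"
      using cone_angle_cut[OF \<alpha>, of "C \<inter> region N T" a] insert.prems by auto
  qed
  finally show ?case using insert by simp
qed (simp add: region_def)

text \<open>A nonzero angle forces full dimension, hence an interior point, at which weak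
  inequalities with nonzero normals are strict.\<close>

lemma region_generic_point:
  fixes \<alpha> :: "'a::euclidean_space set \<Rightarrow> real"
  assumes \<alpha>: "cone_angle \<alpha>" and "finite N" "0 \<notin> N" "T \<subseteq> N" and "\<alpha> (region N T) \<noteq> 0"
  obtains u where "\<And>a. a \<in> T \<Longrightarrow> a \<bullet> u < 0" "\<And>a. a \<in> N - T \<Longrightarrow> a \<bullet> u > 0"
proof -
  let ?R = "region N T"
  have pc: "?R \<in> polyhedral_cones" using assms polyhedral_cone_region by blast
  then have conv: "convex ?R" and "0 \<in> ?R"
    by (auto simp: polyhedral_cones_def convex_cone_def region_def)
  have "dim ?R = DIM('a)"
    using \<alpha> pc assms(5) dim_subset_UNIV[of ?R] unfolding cone_angle_def
    by (meson le_neq_implies_less)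
  then have "aff_dim ?R = int (DIM('a))"
    using \<open>0 \<in> ?R\<close> by (simp add: aff_dim_zero hull_inc)
  then have "interior ?R \<noteq> {}"
    using conv aff_dim_eq_full rel_interior_interior rel_interior_eq_empty \<open>0 \<in> ?R\<close>
    by (metis empty_iff)
  then obtain u where u: "u \<in> interior ?R" by blast
  have "a \<bullet> u < 0" if "a \<in> T" for a
  proof -
    have "interior ?R \<subseteq> interior {x. a \<bullet> x \<le> 0}"
      by (rule interior_mono) (use that in \<open>auto simp: region_def\<close>)
    moreover have "a \<noteq> 0" using that assms by auto
    ultimately show ?thesis using u by (auto simp: interior_halfspace_le)
  qed
  moreover have "a \<bullet> u > 0" if "a \<in> N - T" for a
  proof -
    have "interior ?R \<subseteq> interior {x. a \<bullet> x \<ge> 0}"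
      by (rule interior_mono) (use that in \<open>auto simp: region_def\<close>)
    moreover have "a \<noteq> 0" using that assms by auto
    ultimately show ?thesis using u by (auto simp: interior_halfspace_ge)
  qed
  ultimately show thesis using that by blast
qed

section \<open>Gram's relation\<close>

lemma polyhedron_halfspaces_Int:
  fixes P :: "'a::euclidean_space set"
  assumes "polyhedron P"
  obtains A where "finite A" "P = halfspaces_Int A" "\<And>p. p \<in> A \<Longrightarrow> fst p \<noteq> 0"
proof -
  obtain F where F: "finite F" "P = \<Inter>F" "\<forall>h\<in>F. \<exists>a b. a \<noteq> 0 \<and> h = {x. a \<bullet> x \<le> b}"
    using assms unfolding polyhedron_def by blast
  define f where "f h = (SOME p. fst p \<noteq> 0 \<and> h = {x. fst p \<bullet> x \<le> snd p})" for h :: "'a set"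
  have "\<exists>p. fst p \<noteq> 0 \<and> h = {x. fst p \<bullet> x \<le> snd p}" if h: "h \<in> F" for h
  proof -
    obtain a b where "a \<noteq> 0" "h = {x. a \<bullet> x \<le> b}" using F(3) h by blast
    then show ?thesis by (intro exI[of _ "(a, b)"]) simp
  qed
  then have f: "fst (f h) \<noteq> 0" "h = {x. fst (f h) \<bullet> x \<le> snd (f h)}" if "h \<in> F" for h
    using someI_ex[of "\<lambda>p. fst p \<noteq> 0 \<and> h = {x. fst p \<bullet> x \<le> snd p}"] that
    unfolding f_def by auto
  have "P = halfspaces_Int (f ` F)"
  proof (rule set_eqI)
    fix x
    have "x \<in> h \<longleftrightarrow> fst (f h) \<bullet> x \<le> snd (f h)" if "h \<in> F" for h
      using f(2)[OF that] by blast
    then show "x \<in> P \<longleftrightarrow> x \<in> halfspaces_Int (f ` F)"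
      unfolding F(2) halfspaces_Int_def by simp
  qed
  then show thesis using that[of "f ` F"] F(1) f(1) by blast
qed

text \<open>Expanding each angle over the regions and exchanging the sums leaves, for each region of
  nonzero angle, an alternating count of cells. For \<open>u\<close> interior to the region, these
  are the cells of the half-open polytope in \<open>sum_isign_half_open\<close>.\<close>

lemma gram_cells:
  fixes A :: "('a::euclidean_space \<times> real) set"
  assumes \<alpha>: "cone_angle \<alpha>" and fin: "finite A" and bdd: "bounded (halfspaces_Int A)"
    and nz: "\<And>p. p \<in> A \<Longrightarrow> fst p \<noteq> 0"
  shows "(\<Sum>C\<in>cell A ` halfspaces_Int A. isign (aff_dim C) * \<alpha> (cone_along A C)) = 0"
proof -
  let ?P = "halfspaces_Int A"
  define N where "N = fst ` A"
  \<comment> \<open>The normals tight on \<open>C\<close> decide whether a region counts: it lies in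
    the cone if they all belong to \<open>T\<close>, and otherwise meets it in a set of angle
    0.\<close>
  define tn where "tn C = fst ` {p\<in>A. \<forall>x\<in>C. fst p \<bullet> x = snd p}" for C
  have finN: "finite N" and N0: "0 \<notin> N" using fin nz by (auto simp: N_def)
  have tnN: "tn C \<subseteq> N" for C by (auto simp: tn_def N_def)
  have cone_tn: "cone_along A C = {u. \<forall>a\<in>tn C. a \<bullet> u \<le> 0}" for C
    unfolding cone_along_def tn_def by blast
  have ang: "\<alpha> (cone_along A C) = (\<Sum>T\<in>Pow N. if tn C \<subseteq> T then \<alpha> (region N T) else 0)" for C
  proof -
    have "\<alpha> (cone_along A C \<inter> region N T) = (if tn C \<subseteq> T then \<alpha> (region N T) else 0)"
      if T: "T \<in> Pow N" for T
    proof (cases "tn C \<subseteq> T")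
      case True
      then have "cone_along A C \<inter> region N T = region N T"
        by (auto simp: cone_tn region_def)
      then show ?thesis using True by simp
    next
      case False
      then obtain a where a: "a \<in> tn C" "a \<notin> T" by blast
      then have "a \<in> N - T" using tnN by blast
      then have "cone_along A C \<inter> region N T \<subseteq> {u. a \<bullet> u = 0}" "a \<noteq> 0"
        using a N0 by (auto simp: cone_tn region_def intro: antisym)
      moreover have "cone_along A C \<inter> region N T \<in> polyhedral_cones"
        using T finN by (intro polyhedral_cone_Int polyhedral_cone_along polyhedral_cone_region fin) auto
      ultimately have "\<alpha> (cone_along A C \<inter> region N T) = 0"
        using cone_angle_null[OF \<alpha>] by blast
      then show ?thesis using False by simp
    qed
    then show ?thesis
      using cone_angle_regions[OF \<alpha> finN N0 polyhedral_cone_along[OF fin, of C]] by simp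
  qed
  have "(\<Sum>C\<in>cell A ` ?P. isign (aff_dim C) * \<alpha> (cone_along A C)) =
      (\<Sum>T\<in>Pow N. \<Sum>C\<in>cell A ` ?P. if tn C \<subseteq> T then isign (aff_dim C) * \<alpha> (region N T) else 0)"
    unfolding ang sum_distrib_left
    by (subst sum.swap) (intro sum.cong refl, simp)
  also have "\<dots> = (\<Sum>T\<in>Pow N. 0)"
  proof (rule sum.cong[OF refl])
    fix T assume T: "T \<in> Pow N"
    show "(\<Sum>C\<in>cell A ` ?P. if tn C \<subseteq> T then isign (aff_dim C) * \<alpha> (region N T) else 0) = 0"
    proof (cases "\<alpha> (region N T) = 0")
      case True
      then show ?thesis by (intro sum.neutral) simp
    next
      case False
      then obtain u where u: "\<And>a. a \<in> T \<Longrightarrow> a \<bullet> u < 0" "\<And>a. a \<in> N - T \<Longrightarrow> a \<bullet> u > 0"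
        using region_generic_point[OF \<alpha> finN N0] T by blast
      have T_iff: "fst p \<in> T \<longleftrightarrow> fst p \<bullet> u < 0" "fst p \<bullet> u \<noteq> 0" if "p \<in> A" for p
        using u(1)[of "fst p"] u(2)[of "fst p"] that by (force simp: N_def)+
      define U where "U = {x \<in> ?P. \<forall>p\<in>A. fst p \<bullet> x = snd p \<longrightarrow> fst p \<bullet> u < 0}"
      have tn_cell: "tn (cell A x) \<subseteq> T \<longleftrightarrow> (\<forall>p\<in>A. fst p \<bullet> x = snd p \<longrightarrow> fst p \<bullet> u < 0)" for x
      proof -
        have "tn (cell A x) = fst ` {p\<in>A. fst p \<bullet> x = snd p}"
          unfolding tn_def using tight_all_cell[OF _ order_refl, of _ A x] self_in_cell[of x A] by blast
        then have "tn (cell A x) \<subseteq> T \<longleftrightarrow> (\<forall>p\<in>A. fst p \<bullet> x = snd p \<longrightarrow> fst p \<in> T)"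
          by (simp only: image_subset_iff) blast
        also have "\<dots> \<longleftrightarrow> (\<forall>p\<in>A. fst p \<bullet> x = snd p \<longrightarrow> fst p \<bullet> u < 0)"
          by (intro ball_cong) (simp_all add: T_iff(1))
        finally show ?thesis .
      qed
      have cells: "{C \<in> cell A ` ?P. tn C \<subseteq> T} = cell A ` U"
        using tn_cell unfolding U_def by blast
      have "(\<Sum>C\<in>cell A ` ?P. if tn C \<subseteq> T then isign (aff_dim C) * \<alpha> (region N T) else 0) =
          (\<Sum>C\<in>{C \<in> cell A ` ?P. tn C \<subseteq> T}. isign (aff_dim C) * \<alpha> (region N T))"
        by (rule sum.inter_filter[symmetric]) (rule finite_cells[OF fin])
      also have "\<dots> = (\<Sum>C\<in>cell A ` U. isign (aff_dim C)) * \<alpha> (region N T)"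
        unfolding cells by (rule sum_distrib_right[symmetric])
      also have "\<dots> = 0"
        using sum_isign_half_open[OF fin bdd T_iff(2) U_def] by simp
      finally show ?thesis .
    qed
  qed
  finally show ?thesis by simp
qed

lemma gram_relation:
  fixes P :: "'a::euclidean_space set"
  assumes \<alpha>: "cone_angle \<alpha>" and P: "full_dim_polytope P"
  shows "(\<Sum>i<DIM('a). (-1) ^ i * angle_sum \<alpha> i P) = (-1) ^ (DIM('a) + 1)"
proof -
  have "polyhedron P" "bounded P"
    using P by (auto simp: full_dim_polytope_def polytope_eq_bounded_polyhedron)
  then obtain A where A: "finite A" "P = halfspaces_Int A" "\<And>p. p \<in> A \<Longrightarrow> fst p \<noteq> 0"
    using polyhedron_halfspaces_Int by metis
  have "\<alpha> UNIV = 1" using \<alpha> by (simp add: cone_angle_def)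
  then have "(\<Sum>i<DIM('a). isign (int i) * angle_sum \<alpha> i P) + isign (int DIM('a)) = 0"
    using sum_angle_sum_eq[OF A(1), of \<alpha> isign] gram_cells[OF \<alpha> A(1) _ A(3)] P \<open>bounded P\<close> A(2)
    by metis
  then show ?thesis by (simp add: isign_of_nat)
qed

text \<open>Tangent cones of the two parts of P agree with those of P off the cutting hyperplane and
  dissect those of P on it, so only the splitting of the crossed cells matters.\<close>

lemma cut_relation:
  fixes A :: "('a::euclidean_space \<times> real) set" and l :: "int \<Rightarrow> real"
  assumes \<alpha>: "cone_angle \<alpha>" and fin: "finite A" and "a \<noteq> 0"
  shows "(\<Sum>C\<in>cell (insert (a, b) A) ` halfspaces_Int (insert (a, b) A).
            l (aff_dim C) * \<alpha> (cone_along (insert (a, b) A) C)) +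
         (\<Sum>C\<in>cell (insert (- a, - b) A) ` halfspaces_Int (insert (- a, - b) A).
            l (aff_dim C) * \<alpha> (cone_along (insert (- a, - b) A) C)) =
         (\<Sum>C\<in>cell A ` halfspaces_Int A. l (aff_dim C) * \<alpha> (cone_along A C)) +
         (\<Sum>C | C \<in> cell A ` halfspaces_Int A \<and> crosses (a, b) C.
            (l (aff_dim C) + l (aff_dim C - 1)) * \<alpha> (cone_along A C))"
proof -
  let ?P = "halfspaces_Int A" and ?h = "(a, b)" and ?h' = "(- a, - b)"
  let ?B = "insert ?h A" and ?B' = "insert ?h' A"
  let ?w = "\<lambda>B C. l (aff_dim C) * \<alpha> (cone_along B C)"
  \<comment> \<open>Reversing the pair gives the same hyperplane, so both halves are unions of cells
    of the one arrangement \<open>?B\<close>.\<close>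
  have side': "side ?h' x = - side ?h x" for x
    by (simp add: side_def sgn_if)
  have cell': "cell ?B' = cell ?B"
    by (rule ext) (simp add: cell_insert side')
  have halves: "halfspaces_Int ?B = {x\<in>?P. side ?h x \<le> 0}" "halfspaces_Int ?B' = {x\<in>?P. side ?h x \<ge> 0}"
    by (auto simp: halfspaces_Int_def side_def)
  define X where "X s = cell ?B ` {x\<in>?P. side ?h x = s}" for s
  have finX: "finite (X s)" for s
    unfolding X_def by (rule finite_cells) (simp add: fin)
  have disj: "X s \<inter> X s' = {}" if "s \<noteq> s'" for s s'
  proof (rule equals0I)
    fix C assume "C \<in> X s \<inter> X s'"
    then obtain x y where "side ?h x = s" "side ?h y = s'" "cell ?B x = cell ?B y"
      unfolding X_def by auto
    then show False using that self_in_cell[of x ?B] by (simp add: cell_insert)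
  qed
  have eqs: "cell ?B ` halfspaces_Int ?B = X (-1) \<union> X 0"
    "cell ?B' ` halfspaces_Int ?B' = X 0 \<union> X 1" "cell ?B ` ?P = X (-1) \<union> X 0 \<union> X 1"
  proof -
    have *: "{x\<in>?P. side ?h x \<le> 0} = {x\<in>?P. side ?h x = -1} \<union> {x\<in>?P. side ?h x = 0}"
      "{x\<in>?P. side ?h x \<ge> 0} = {x\<in>?P. side ?h x = 0} \<union> {x\<in>?P. side ?h x = 1}"
      "?P = {x\<in>?P. side ?h x = -1} \<union> {x\<in>?P. side ?h x = 0} \<union> {x\<in>?P. side ?h x = 1}"
      using side_cases[of ?h] by force+
    show "cell ?B ` halfspaces_Int ?B = X (-1) \<union> X 0"
      "cell ?B' ` halfspaces_Int ?B' = X 0 \<union> X 1" "cell ?B ` ?P = X (-1) \<union> X 0 \<union> X 1"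
      unfolding X_def cell' halves image_Un[symmetric] by (simp_all only: *(1,2) *(3)[symmetric])
  qed
  have coneB: "cone_along ?B (cell ?B x) = (if side ?h x = 0 then cone_along A (cell ?B x) \<inter> {u. a \<bullet> u \<le> 0}
      else cone_along A (cell ?B x))"
    "cone_along ?B' (cell ?B x) = (if side ?h x = 0 then cone_along A (cell ?B x) \<inter> {u. a \<bullet> u \<ge> 0}
      else cone_along A (cell ?B x))" for x
  proof -
    have ne: "cell ?B x \<noteq> {}" using self_in_cell[of x ?B] by blast
    have 1: "(\<forall>y\<in>cell ?B x. a \<bullet> y = b) \<longleftrightarrow> side ?h x = 0"
      using tight_all_cell[of ?h ?B "cell ?B x" x] ne side_simps(1)[of ?h x] by simp
    show "cone_along ?B (cell ?B x) = (if side ?h x = 0 then cone_along A (cell ?B x) \<inter> {u. a \<bullet> u \<le> 0}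
        else cone_along A (cell ?B x))"
      "cone_along ?B' (cell ?B x) = (if side ?h x = 0 then cone_along A (cell ?B x) \<inter> {u. a \<bullet> u \<ge> 0}
        else cone_along A (cell ?B x))"
      unfolding cone_along_def using 1 by auto
  qed
  have w1: "sum (?w ?B) (X (-1)) = sum (?w A) (X (-1))"
    by (rule sum.cong) (auto simp: X_def coneB)
  have w2: "sum (?w ?B') (X 1) = sum (?w A) (X 1)"
    by (rule sum.cong) (auto simp: X_def coneB)
  \<comment> \<open>Cells on the cutting hyperplane belong to both parts, and their two cones are
    the halves of the cone taken in \<open>A\<close>, so the angles add up.\<close>
  have "?w ?B C + ?w ?B' C = ?w A C" if C: "C \<in> X 0" for C
  proof -
    obtain x where x: "C = cell ?B x" "side ?h x = 0" using C unfolding X_def by blast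
    show ?thesis
      using cone_angle_cut[OF \<alpha> polyhedral_cone_along[OF fin, of C] assms(3)]
      unfolding x(1) by (simp add: coneB x(2) distrib_left)
  qed
  then have w3: "sum (?w ?B) (X 0) + sum (?w ?B') (X 0) = sum (?w A) (X 0)"
    by (simp add: sum.distrib[symmetric])
  have "sum (?w ?B) (cell ?B ` halfspaces_Int ?B) + sum (?w ?B') (cell ?B' ` halfspaces_Int ?B') =
      sum (?w A) (X (-1)) + sum (?w A) (X 0) + sum (?w A) (X 1)"
    unfolding eqs using w1 w2 w3 disj[of "-1" 0] disj[of 0 1] by (simp add: sum.union_disjoint finX)
  also have "\<dots> = sum (?w A) (cell ?B ` ?P)"
    unfolding eqs using disj[of "-1" 0] disj[of 0 1] disj[of "-1" 1]
    by (simp add: sum.union_disjoint finX Int_Un_distrib2)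
  also have "\<dots> = sum (?w A) (cell A ` ?P) +
         (\<Sum>C | C \<in> cell A ` ?P \<and> crosses ?h C. (l (aff_dim C) + l (aff_dim C - 1)) * \<alpha> (cone_along A C))"
  \<comment> \<open>The weight \<open>\<alpha> (cone_along A C)\<close> sees only the constraints of
    \<open>A\<close> tight on \<open>C\<close>, so refining by \<open>?h\<close> does not alter
    it.\<close>
  proof (rule sum_cell_insert[OF fin])
    show "cell A x \<subseteq> ?P" if "x \<in> ?P" for x using cell_subset_halfspaces_Int[OF that] .
    fix y
    have "cell ?B y \<subseteq> cell A y" "cell ?B y \<noteq> {}" "cell A y \<noteq> {}"
      using self_in_cell[of y ?B] self_in_cell[of y A] by (auto simp: cell_insert)
    then have "cone_along A (cell ?B y) = cone_along A (cell A y)"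
      by (simp add: cone_along_cell[of _ A y])
    then show "\<alpha> (cone_along A (cell ?B y)) = \<alpha> (cone_along A (cell A y))" by simp
  qed
  finally show ?thesis .
qed

subsection \<open>Uniqueness\<close>

lemma full_dim_polytope_halfspaces_Int:
  fixes A :: "('a::euclidean_space \<times> real) set"
  assumes fin: "finite A" and bdd: "bounded (halfspaces_Int A)"
    and x: "\<And>p. p \<in> A \<Longrightarrow> fst p \<bullet> x < snd p"
  shows "full_dim_polytope (halfspaces_Int A)"
proof -
  let ?P = "halfspaces_Int A"
  have eq: "?P = \<Inter>((\<lambda>p. {x. fst p \<bullet> x \<le> snd p}) ` A)"
    by (auto simp: halfspaces_Int_def)
  have "polyhedron ?P"
    unfolding eq by (rule polyhedron_Inter) (use fin in \<open>auto simp: polyhedron_halfspace_le\<close>)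
  then have poly: "polytope ?P" using bdd by (simp add: polytope_eq_bounded_polyhedron)
  let ?O = "\<Inter>p\<in>A. {x. fst p \<bullet> x < snd p}"
  have "open ?O" using fin by (intro open_INT) (auto simp: open_halfspace_lt)
  moreover have "?O \<subseteq> ?P" by (force simp: halfspaces_Int_def)
  moreover have "x \<in> ?O" using x by blast
  ultimately have "interior ?P \<noteq> {}" using interior_maximal by blast
  then show ?thesis
    using poly aff_dim_nonempty_interior by (auto simp: full_dim_polytope_def)
qed

section \<open>Double cone prisms as test polytopes\<close>

lemma dim_coordinate_subspace:
  assumes "J \<subseteq> Basis"
  shows "dim {v::'a::euclidean_space. \<forall>i\<in>J. i \<bullet> v = 0} = DIM('a) - card J"
proof -
  have "{v::'a. \<forall>i\<in>J. i \<bullet> v = 0} = {v. \<forall>i\<in>Basis. i \<notin> Basis - J \<longrightarrow> v \<bullet> i = 0}"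
    using assms by (auto simp: inner_commute)
  then show ?thesis
    using dim_substandard[of "Basis - J"] assms
    by (simp add: card_Diff_subset finite_subset[OF assms finite_Basis])
qed

text \<open>The product of the cube in the coordinates K with the double cone
  \<open>max (\<bar>x\<^sub>i\<bar>) + \<bar>x\<^sub>e\<bar> \<le> 1\<close>, i ranging over the remaining coordinates other than e.
  Cutting by \<open>x\<^sub>e = 0\<close> crosses no proper face of the double cone.\<close>

definition bicone_prism :: "'a::euclidean_space \<Rightarrow> 'a set \<Rightarrow> ('a \<times> real) set" where
  "bicone_prism e K =
     (\<lambda>s. (s *\<^sub>R e, 1)) ` {1, -1} \<union>
     (\<lambda>(i, s, r). (s *\<^sub>R i + r *\<^sub>R e, 1)) ` ((Basis - {e} - K) \<times> {1, -1} \<times> {1, -1}) \<union>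
     (\<lambda>(i, s). (s *\<^sub>R i, 1)) ` (K \<times> {1, -1})"

lemma finite_bicone_prism: "K \<subseteq> Basis \<Longrightarrow> finite (bicone_prism e K)"
  using finite_subset[OF _ finite_Basis, of K] by (auto simp: bicone_prism_def)

text \<open>Turns a condition on all constraints into an explicit list; signs, tightness and cones
  are read off below by choosing \<open>Q\<close>.\<close>

lemma ball_bicone_prism:
  "(\<forall>p\<in>bicone_prism e K. Q p) \<longleftrightarrow>
     Q (e, 1) \<and> Q (- e, 1) \<and>
     (\<forall>i\<in>Basis - {e} - K. Q (i + e, 1) \<and> Q (i - e, 1) \<and> Q (- i + e, 1) \<and> Q (- i - e, 1)) \<and>
     (\<forall>i\<in>K. Q (i, 1) \<and> Q (- i, 1))"
  unfolding bicone_prism_def ball_Un by (auto simp: minus_diff_commute)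

lemma mem_bicone_prism_iff:
  "x \<in> halfspaces_Int (bicone_prism e K) \<longleftrightarrow>
     \<bar>e \<bullet> x\<bar> \<le> 1 \<and> (\<forall>i\<in>Basis - {e} - K. \<bar>i \<bullet> x\<bar> + \<bar>e \<bullet> x\<bar> \<le> 1) \<and> (\<forall>i\<in>K. \<bar>i \<bullet> x\<bar> \<le> 1)"
proof -
  have 1: "(i + e) \<bullet> x \<le> 1 \<and> (i - e) \<bullet> x \<le> 1 \<and> (- i + e) \<bullet> x \<le> 1 \<and> (- i - e) \<bullet> x \<le> 1 \<longleftrightarrow>
      \<bar>i \<bullet> x\<bar> + \<bar>e \<bullet> x\<bar> \<le> 1" for i
    unfolding inner_add_left inner_diff_left inner_minus_left by arith
  have 2: "i \<bullet> x \<le> 1 \<and> (- i) \<bullet> x \<le> 1 \<longleftrightarrow> \<bar>i \<bullet> x\<bar> \<le> 1" for i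
    unfolding inner_minus_left by arith
  show ?thesis
    unfolding halfspaces_Int_def mem_Collect_eq ball_bicone_prism fst_conv snd_conv 1 2
    using 2 by metis
qed

lemma bounded_bicone_prism:
  assumes "e \<in> Basis"
  shows "bounded (halfspaces_Int (bicone_prism e K))"
  unfolding bounded_iff
proof (intro exI ballI)
  fix x :: 'a assume x: "x \<in> halfspaces_Int (bicone_prism e K)"
  have "\<bar>x \<bullet> i\<bar> \<le> 1" if "i \<in> Basis" for i
  proof -
    consider "i = e" | "i \<in> K" | "i \<in> Basis - {e} - K" using \<open>i \<in> Basis\<close> by blast
    then show ?thesis
      using x unfolding mem_bicone_prism_iff by cases (force simp: inner_commute)+
  qed
  then have "(\<Sum>i\<in>Basis. \<bar>x \<bullet> i\<bar>) \<le> (\<Sum>i\<in>(Basis::'a set). 1)" by (rule sum_mono)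
  then show "norm x \<le> (\<Sum>i\<in>(Basis::'a set). 1)" using norm_le_l1[of x] by linarith
qed

text \<open>A constraint involving \<open>e\<close> cannot be tight at a point whose
  \<open>e\<close>-coordinate has the sign opposite to its coefficient. A crossed cell has points of
  both signs, and tightness is the same all over a cell, so all these constraints are slack.\<close>

lemma bicone_prism_crossed_tight:
  assumes x: "x \<in> halfspaces_Int (bicone_prism e K)"
    and cr: "crosses (e, 0) (cell (bicone_prism e K) x)"
  shows "\<bar>e \<bullet> x\<bar> < 1" "\<And>i. i \<in> Basis - {e} - K \<Longrightarrow> \<bar>i \<bullet> x\<bar> + \<bar>e \<bullet> x\<bar> < 1"
proof -
  let ?A = "bicone_prism e K"
  obtain y z where y: "y \<in> cell ?A x" "e \<bullet> y < 0" and z: "z \<in> cell ?A x" "e \<bullet> z > 0"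
    using cr by (auto simp: crosses_def)
  have yP: "y \<in> halfspaces_Int ?A" and zP: "z \<in> halfspaces_Int ?A"
    using cell_subset_halfspaces_Int[OF x] y z by auto
  have tight: "(fst p \<bullet> x = snd p \<longleftrightarrow> fst p \<bullet> y = snd p) \<and> (fst p \<bullet> x = snd p \<longleftrightarrow> fst p \<bullet> z = snd p)"
    if "p \<in> ?A" for p
    using tight_cell(1)[OF y(1) that] tight_cell(1)[OF z(1) that] by simp
  have all_tight: "\<forall>p\<in>?A. (fst p \<bullet> x = snd p \<longleftrightarrow> fst p \<bullet> y = snd p) \<and> (fst p \<bullet> x = snd p \<longleftrightarrow> fst p \<bullet> z = snd p)"
    using tight by blast
  note t = all_tight[unfolded ball_bicone_prism fst_conv snd_conv inner_minus_left inner_add_left inner_diff_left]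
  show "\<bar>e \<bullet> x\<bar> < 1"
  proof -
    have "\<bar>e \<bullet> x\<bar> \<le> 1" using x by (simp add: mem_bicone_prism_iff)
    then show ?thesis using t y(2) z(2) by linarith
  qed
  fix i assume i: "i \<in> Basis - {e} - K"
  have le: "\<bar>i \<bullet> x\<bar> + \<bar>e \<bullet> x\<bar> \<le> 1" "\<bar>i \<bullet> y\<bar> + \<bar>e \<bullet> y\<bar> \<le> 1" "\<bar>i \<bullet> z\<bar> + \<bar>e \<bullet> z\<bar> \<le> 1"
    using x yP zP i by (auto simp: mem_bicone_prism_iff)
  have ti: "(i \<bullet> x + e \<bullet> x = 1 \<longleftrightarrow> i \<bullet> y + e \<bullet> y = 1) \<and> (i \<bullet> x + e \<bullet> x = 1 \<longleftrightarrow> i \<bullet> z + e \<bullet> z = 1)"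
    "(i \<bullet> x - e \<bullet> x = 1 \<longleftrightarrow> i \<bullet> y - e \<bullet> y = 1) \<and> (i \<bullet> x - e \<bullet> x = 1 \<longleftrightarrow> i \<bullet> z - e \<bullet> z = 1)"
    "(- (i \<bullet> x) + e \<bullet> x = 1 \<longleftrightarrow> - (i \<bullet> y) + e \<bullet> y = 1) \<and> (- (i \<bullet> x) + e \<bullet> x = 1 \<longleftrightarrow> - (i \<bullet> z) + e \<bullet> z = 1)"
    "(- (i \<bullet> x) - e \<bullet> x = 1 \<longleftrightarrow> - (i \<bullet> y) - e \<bullet> y = 1) \<and> (- (i \<bullet> x) - e \<bullet> x = 1 \<longleftrightarrow> - (i \<bullet> z) - e \<bullet> z = 1)"
    using t i by blast+
  have "i \<bullet> y + e \<bullet> y \<noteq> 1" "- (i \<bullet> y) + e \<bullet> y \<noteq> 1" "i \<bullet> z - e \<bullet> z \<noteq> 1" "- (i \<bullet> z) - e \<bullet> z \<noteq> 1"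
    using le y(2) z(2) by linarith+
  then have "i \<bullet> x + e \<bullet> x \<noteq> 1" "- (i \<bullet> x) + e \<bullet> x \<noteq> 1" "i \<bullet> x - e \<bullet> x \<noteq> 1" "- (i \<bullet> x) - e \<bullet> x \<noteq> 1"
    using ti by blast+
  then show "\<bar>i \<bullet> x\<bar> + \<bar>e \<bullet> x\<bar> < 1" using le(1) by linarith
qed

text \<open>Only constraints of the cube factor can be tight at such \<open>x\<close>, so the
  coordinates in \<open>K\<close> govern the cell and its cone.\<close>

lemma cell_dir_bicone_prism:
  assumes "\<bar>e \<bullet> x\<bar> < 1" "\<And>i. i \<in> Basis - {e} - K \<Longrightarrow> \<bar>i \<bullet> x\<bar> + \<bar>e \<bullet> x\<bar> < 1"
  shows "cell_dir (bicone_prism e K) x = {v. \<forall>i\<in>{i\<in>K. \<bar>i \<bullet> x\<bar> = 1}. i \<bullet> v = 0}"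
    and "cone_along (bicone_prism e K) (cell (bicone_prism e K) x) =
      {u. \<forall>i\<in>K. (i \<bullet> x = 1 \<longrightarrow> i \<bullet> u \<le> 0) \<and> (i \<bullet> x = -1 \<longrightarrow> i \<bullet> u \<ge> 0)}"
proof -
  have e: "e \<bullet> x \<noteq> 1" "- (e \<bullet> x) \<noteq> 1" using assms(1) by auto
  have ie: "i \<bullet> x + e \<bullet> x \<noteq> 1" "i \<bullet> x - e \<bullet> x \<noteq> 1" "- (i \<bullet> x) + e \<bullet> x \<noteq> 1" "- (i \<bullet> x) - e \<bullet> x \<noteq> 1"
    if "i \<in> Basis - {e} - K" for i
    using assms(2)[OF that] by linarith+
  have m: "- (i \<bullet> x) = 1 \<longleftrightarrow> i \<bullet> x = -1" for i by auto
  show "cell_dir (bicone_prism e K) x = {v. \<forall>i\<in>{i\<in>K. \<bar>i \<bullet> x\<bar> = 1}. i \<bullet> v = 0}"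
    unfolding cell_dir_def ball_bicone_prism
    using e ie by (auto simp: inner_add_left inner_diff_left abs_if m split: if_splits)
  have "cone_along (bicone_prism e K) (cell (bicone_prism e K) x) =
      {u. \<forall>p\<in>bicone_prism e K. fst p \<bullet> x = snd p \<longrightarrow> fst p \<bullet> u \<le> 0}"
    using self_in_cell[of x "bicone_prism e K"] by (intro cone_along_cell) auto
  also have "\<dots> = {u. \<forall>i\<in>K. (i \<bullet> x = 1 \<longrightarrow> i \<bullet> u \<le> 0) \<and> (i \<bullet> x = -1 \<longrightarrow> i \<bullet> u \<ge> 0)}"
    unfolding ball_bicone_prism
    using e ie by (auto simp: inner_add_left inner_diff_left m)
  finally show "cone_along (bicone_prism e K) (cell (bicone_prism e K) x) =
      {u. \<forall>i\<in>K. (i \<bullet> x = 1 \<longrightarrow> i \<bullet> u \<le> 0) \<and> (i \<bullet> x = -1 \<longrightarrow> i \<bullet> u \<ge> 0)}" .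
qed

text \<open>A crossed cell on which j cube coordinates are tight has dimension
  \<open>DIM('a) - j\<close>. The hypothesis on \<open>m\<close> removes those with
  \<open>j < card K\<close>, leaving one cell for each vertex of the cube; their cones are the
  regions of \<open>K\<close>, whose angles add up to \<open>\<alpha> UNIV = 1\<close>.\<close>

lemma sum_crossed_bicone_prism:
  fixes e :: "'a::euclidean_space" and m :: "int \<Rightarrow> real"
  assumes \<alpha>: "cone_angle \<alpha>" and e: "e \<in> Basis" and K: "K \<subseteq> Basis - {e}"
    and m: "\<And>j. j < card K \<Longrightarrow> m (int (DIM('a) - j)) = 0"
  shows "(\<Sum>C | C \<in> cell (bicone_prism e K) ` halfspaces_Int (bicone_prism e K) \<and> crosses (e, 0) C.
            m (aff_dim C) * \<alpha> (cone_along (bicone_prism e K) C)) = m (int (DIM('a) - card K))"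
proof -
  let ?A = "bicone_prism e K" and ?d = "DIM('a)"
  let ?S = "{C. C \<in> cell ?A ` halfspaces_Int ?A \<and> crosses (e, 0) C}"
  let ?w = "\<lambda>C. m (aff_dim C) * \<alpha> (cone_along ?A C)"
  have KB: "K \<subseteq> Basis" and finK: "finite K"
    using K by (auto intro: finite_subset[OF _ finite_Basis])
  have finA: "finite ?A" using KB by (rule finite_bicone_prism)
  have finS: "finite ?S" by (rule finite_subset[OF _ finite_cells[OF finA]]) auto
  \<comment> \<open>The vertex of the cube with positive coordinates in \<open>T\<close>, at the
    centre of the double cone.\<close>
  define v where "v T = (\<Sum>i\<in>K. (if i \<in> T then 1 else -1) *\<^sub>R i)" for T
  have v_inner: "i \<bullet> v T = (if i \<in> K then if i \<in> T then 1 else -1 else 0)" if i: "i \<in> Basis" for i T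
  proof -
    have "i \<bullet> v T = (\<Sum>j\<in>K. (if j \<in> T then 1 else -1) * (i \<bullet> j))"
      by (simp add: v_def inner_sum_right)
    also have "\<dots> = (\<Sum>j\<in>K. if j = i then (if i \<in> T then 1 else -1) else 0)"
      by (rule sum.cong) (use KB i in \<open>auto simp: inner_Basis\<close>)
    also have "\<dots> = (if i \<in> K then if i \<in> T then 1 else -1 else 0)"
      using finK by (simp add: sum.delta')
    finally show ?thesis .
  qed
  have ve: "e \<bullet> v T = 0" for T using v_inner[OF e] K by auto
  have vi: "i \<bullet> v T = 0" if "i \<in> Basis - {e} - K" for i T using v_inner[of i] that by auto
  have vK: "i \<bullet> v T = (if i \<in> T then 1 else -1)" if "i \<in> K" for i T
    using v_inner[of i] that KB by auto
  have vP: "v T \<in> halfspaces_Int ?A" for T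
    by (auto simp: mem_bicone_prism_iff ve vi vK)
  \<comment> \<open>A move along \<open>e\<close> by less than 1 does not change the cube
    coordinates and keeps the double cone constraints slack; going both ways shows that the cell is
    crossed.\<close>
  have v_shift: "v T + r *\<^sub>R e \<in> cell ?A (v T)" if r: "\<bar>r\<bar> < 1" for T r
  proof -
    have ee: "e \<bullet> e = 1" using e by simp
    have ei: "i \<bullet> e = 0" if "i \<in> Basis - {e}" for i using that e by (simp add: inner_Basis)
    have r': "r < 1" "- r < 1" using r by auto
    show ?thesis
      unfolding cell_def mem_Collect_eq ball_bicone_prism side_def fst_conv snd_conv
      using r' K by (auto simp: inner_add_right inner_add_left inner_diff_left ve vi ee ei subset_iff)
  qed
  have v_cross: "crosses (e, 0) (cell ?A (v T))" for T
    unfolding crosses_def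
  proof (intro conjI bexI)
    show "fst (e, 0) \<bullet> (v T + (- 1 / 2) *\<^sub>R e) < snd (e, 0)"
      "fst (e, 0) \<bullet> (v T + (1 / 2) *\<^sub>R e) > snd (e, 0)"
      using e by (simp_all add: inner_add_right ve inner_diff_right)
  qed (intro v_shift, simp)+
  have v_dir: "cell_dir ?A (v T) = {u. \<forall>i\<in>K. i \<bullet> u = 0}"
    and v_cone: "cone_along ?A (cell ?A (v T)) = region K T" if "T \<subseteq> K" for T
    using cell_dir_bicone_prism[of e "v T" K] ve vi vK that by (auto simp: region_def)
  have v_dim: "aff_dim (cell ?A (v T)) = int (?d - card K)" if "T \<subseteq> K" for T
    using aff_dim_cell[OF finA, of "v T"] v_dir[OF that] dim_coordinate_subspace[OF KB] by simp
  have inj: "inj_on (\<lambda>T. cell ?A (v T)) (Pow K)"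
  proof (rule inj_onI)
    fix T T' assume T: "T \<in> Pow K" "T' \<in> Pow K" "cell ?A (v T) = cell ?A (v T')"
    then have "v T \<in> cell ?A (v T')" by (simp add: cell_eq_iff)
    then have "\<forall>i\<in>K. side (i, 1) (v T) = side (i, 1) (v T')"
      unfolding cell_def mem_Collect_eq ball_bicone_prism by blast
    then have "i \<in> T \<longleftrightarrow> i \<in> T'" if "i \<in> K" for i
      using that by (auto simp: side_def vK split: if_splits)
    then show "T = T'" using T by blast
  qed
  have dim_crossed: "aff_dim (cell ?A x) = int (?d - card {i\<in>K. \<bar>i \<bullet> x\<bar> = 1})"
    if x: "x \<in> halfspaces_Int ?A" "crosses (e, 0) (cell ?A x)" for x
  proof -
    have "{i\<in>K. \<bar>i \<bullet> x\<bar> = 1} \<subseteq> Basis" using KB by blast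
    moreover have "cell_dir ?A x = {v. \<forall>i\<in>{i\<in>K. \<bar>i \<bullet> x\<bar> = 1}. i \<bullet> v = 0}"
      by (rule cell_dir_bicone_prism(1)) (use bicone_prism_crossed_tight[OF x] in blast)+
    ultimately show ?thesis
      by (simp only: aff_dim_cell[OF finA] dim_coordinate_subspace)
  qed
  have S': "{C \<in> ?S. aff_dim C = int (?d - card K)} = (\<lambda>T. cell ?A (v T)) ` Pow K"
  proof (intro equalityI subsetI)
    fix C assume "C \<in> (\<lambda>T. cell ?A (v T)) ` Pow K"
    then show "C \<in> {C \<in> ?S. aff_dim C = int (?d - card K)}"
      using vP v_cross v_dim by blast
  next
    fix C assume "C \<in> {C \<in> ?S. aff_dim C = int (?d - card K)}"
    then obtain x where x: "x \<in> halfspaces_Int ?A" "C = cell ?A x" "crosses (e, 0) (cell ?A x)"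
        "aff_dim (cell ?A x) = int (?d - card K)" by blast
    note nt = bicone_prism_crossed_tight[OF x(1,3)]
    let ?J = "{i\<in>K. \<bar>i \<bullet> x\<bar> = 1}"
    \<comment> \<open>The least dimension forces every coordinate in \<open>K\<close> to be tight;
      \<open>card K \<le> ?d\<close> excludes truncation in the subtractions.\<close>
    have "int (?d - card ?J) = int (?d - card K)" using x(3,4) dim_crossed[OF x(1)] by simp
    moreover have "card K \<le> ?d" "card ?J \<le> card K"
      using KB finK by (auto intro: card_mono)
    ultimately have "card ?J = card K" by linarith
    then have "?J = K" using finK by (intro card_subset_eq) auto
    then have xK: "i \<bullet> x = 1 \<or> i \<bullet> x = -1" if "i \<in> K" for i
      using that by (auto simp: abs_if split: if_splits)
    define T where "T = {i\<in>K. i \<bullet> x = 1}"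
    have xv: "i \<bullet> x = i \<bullet> v T" if "i \<in> K" for i
      using xK[OF that] that by (auto simp: vK T_def)
    have nt': "i \<bullet> x + e \<bullet> x < 1" "i \<bullet> x - e \<bullet> x < 1" "- (i \<bullet> x) + e \<bullet> x < 1" "- (i \<bullet> x) - e \<bullet> x < 1"
      if "i \<in> Basis - {e} - K" for i
      using nt(2)[OF that] by linarith+
    have "x \<in> cell ?A (v T)"
      unfolding cell_def mem_Collect_eq ball_bicone_prism side_def fst_conv snd_conv
      using nt(1) nt' by (auto simp: inner_add_left inner_diff_left ve vi xv)
    then have "C = cell ?A (v T)" using x(2) cell_eqI by blast
    then show "C \<in> (\<lambda>T. cell ?A (v T)) ` Pow K" by (auto simp: T_def)
  qed
  have "sum ?w ?S = sum ?w {C \<in> ?S. aff_dim C = int (?d - card K)}"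
  proof (rule sum.mono_neutral_right[OF finS])
    show "\<forall>C\<in>?S - {C \<in> ?S. aff_dim C = int (?d - card K)}. ?w C = 0"
    proof
      fix C assume C: "C \<in> ?S - {C \<in> ?S. aff_dim C = int (?d - card K)}"
      then obtain x where x: "x \<in> halfspaces_Int ?A" "C = cell ?A x" "crosses (e, 0) (cell ?A x)" by blast
      let ?J = "{i\<in>K. \<bar>i \<bullet> x\<bar> = 1}"
      have dim: "aff_dim C = int (?d - card ?J)" using x dim_crossed by simp
      moreover have "card ?J \<noteq> card K" using C dim by auto
      moreover have "card ?J \<le> card K" using finK by (auto intro: card_mono)
      ultimately show "?w C = 0" using m[of "card ?J"] by simp
    qed
  qed auto
  also have "\<dots> = (\<Sum>T\<in>Pow K. ?w (cell ?A (v T)))"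
    unfolding S' by (rule sum.reindex[OF inj, unfolded comp_def])
  also have "\<dots> = m (int (?d - card K)) * (\<Sum>T\<in>Pow K. \<alpha> (UNIV \<inter> region K T))"
    unfolding sum_distrib_left by (rule sum.cong) (auto simp: v_dim v_cone)
  also have "(\<Sum>T\<in>Pow K. \<alpha> (UNIV \<inter> region K T)) = \<alpha> UNIV"
    by (rule cone_angle_regions[symmetric, OF \<alpha> finK _ polyhedral_cone_UNIV])
      (use KB nonzero_Basis in blast)
  also have "\<alpha> UNIV = 1" using \<alpha> by (simp add: cone_angle_def)
  finally show ?thesis by simp
qed

text \<open>Induction on the number k of cube coordinates: the prism and its two halves all satisfy
  the relation, so the sum over the crossed cells is 0, and the pairs already known to cancel remove
  all but the cells of dimension d - k.\<close>

lemma gram_relation_unique: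
  fixes \<alpha> :: "'a::euclidean_space set \<Rightarrow> real" and l :: "nat \<Rightarrow> real"
  assumes \<alpha>: "cone_angle \<alpha>"
    and rel: "\<And>P. full_dim_polytope P \<Longrightarrow> (\<Sum>i<DIM('a). l i * angle_sum \<alpha> i P) = c"
  shows "\<exists>t. (\<forall>i<DIM('a). l i = t * (-1) ^ i) \<and> c = t * (-1) ^ (DIM('a) + 1)"
proof -
  let ?d = "DIM('a)"
  \<comment> \<open>The constant becomes the weight of the improper face, as in
    \<open>sum_angle_sum_eq\<close>.\<close>
  define L where "L k = (if k = int ?d then - c else l (nat k))" for k
  have L0: "(\<Sum>C\<in>cell A ` halfspaces_Int A. L (aff_dim C) * \<alpha> (cone_along A C)) = 0"
    if A: "finite A" "full_dim_polytope (halfspaces_Int A)" for A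
  proof -
    have "(\<Sum>i<?d. L (int i) * angle_sum \<alpha> i (halfspaces_Int A)) = c"
      using rel[OF A(2)] by (simp add: L_def)
    then show ?thesis
      using sum_angle_sum_eq[OF A, of \<alpha> L] \<alpha> by (simp add: cone_angle_def L_def)
  qed
  \<comment> \<open>One coordinate is reserved for \<open>e\<close>, hence \<open>k < ?d\<close>;
    the last case k = d - 1 links \<open>L 1\<close> to \<open>L 0\<close>.\<close>
  have m0: "L (int (?d - k)) + L (int (?d - k) - 1) = 0" if "k < ?d" for k
    using that
  proof (induction k rule: less_induct)
    case (less k)
    obtain e :: 'a where e: "e \<in> Basis" using nonempty_Basis by blast
    have "k \<le> card (Basis - {e})" using less.prems e by simp
    then obtain K where K: "K \<subseteq> Basis - {e}" "card K = k"
      by (rule obtain_subset_with_card_n)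
    let ?A = "bicone_prism e K"
    have KB: "K \<subseteq> Basis" using K by blast
    have finA: "finite ?A" using KB by (rule finite_bicone_prism)
    have bdd: "bounded (halfspaces_Int ?A)" using e by (rule bounded_bicone_prism)
    have bddB: "bounded (halfspaces_Int (insert h ?A))" for h
      by (rule bounded_subset[OF bdd]) (auto simp: halfspaces_Int_def)
    have ei: "i \<bullet> e = 0" if "i \<in> Basis - {e}" for i using that e by (simp add: inner_Basis)
    \<comment> \<open>Points of the axis witness full dimension: 0 for the prism, and half of
      \<open>- e\<close> and of \<open>e\<close> for the two parts.\<close>
    have strict: "fst p \<bullet> (r *\<^sub>R e) < snd p" if "p \<in> ?A" "\<bar>r\<bar> < 1" for p r
    proof -
      have r: "r < 1" "- r < 1" using that by auto
      have "\<forall>p\<in>?A. fst p \<bullet> (r *\<^sub>R e) < snd p"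
        unfolding ball_bicone_prism
        using r K e ei by (auto simp: inner_add_left inner_diff_left subset_iff)
      then show ?thesis using that by blast
    qed
    have "full_dim_polytope (halfspaces_Int ?A)"
      by (rule full_dim_polytope_halfspaces_Int[OF finA bdd, of "0 *\<^sub>R e"]) (use strict[of _ 0] in simp)
    moreover have "full_dim_polytope (halfspaces_Int (insert (e, 0) ?A))"
    proof (rule full_dim_polytope_halfspaces_Int[OF _ bddB, of _ "(- 1 / 2) *\<^sub>R e"])
      fix p assume "p \<in> insert (e, 0) ?A"
      then show "fst p \<bullet> ((- 1 / 2) *\<^sub>R e) < snd p"
        using strict[of p "- 1 / 2"] e by auto
    qed (simp add: finA)
    moreover have "full_dim_polytope (halfspaces_Int (insert (- e, - 0) ?A))"
    proof (rule full_dim_polytope_halfspaces_Int[OF _ bddB, of _ "(1 / 2) *\<^sub>R e"])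
      fix p assume "p \<in> insert (- e, - 0) ?A"
      then show "fst p \<bullet> ((1 / 2) *\<^sub>R e) < snd p"
        using strict[of p "1 / 2"] e by auto
    qed (simp add: finA)
    ultimately have "(\<Sum>C | C \<in> cell ?A ` halfspaces_Int ?A \<and> crosses (e, 0) C.
        (L (aff_dim C) + L (aff_dim C - 1)) * \<alpha> (cone_along ?A C)) = 0"
      using cut_relation[OF \<alpha> finA, where a = e and b = 0 and l = L] e nonzero_Basis[OF e] L0[OF finA] L0[of "insert (e, 0) ?A"]
        L0[of "insert (- e, - 0) ?A"] finA by simp
    then show ?case
      using sum_crossed_bicone_prism[OF \<alpha> e K(1), of "\<lambda>k. L k + L (k - 1)"] less.IH less.prems K(2)
      by simp
  qed
  \<comment> \<open>Starting from \<open>L 0\<close>, the signs alternate up to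
    \<open>L (int ?d) = - c\<close>.\<close>
  have Lj: "L (int j) = (-1) ^ j * L 0" if "j \<le> ?d" for j
    using that
  proof (induction j)
    case (Suc j)
    have "L (int (Suc j)) + L (int (Suc j) - 1) = 0"
      using m0[of "?d - Suc j"] Suc.prems by simp
    then show ?case using Suc by simp
  qed simp
  show ?thesis
  proof (intro exI conjI allI impI)
    fix i assume "i < ?d"
    then show "l i = L 0 * (-1) ^ i" using Lj[of i] by (simp add: L_def)
  next
    show "c = L 0 * (-1) ^ (?d + 1)" using Lj[of ?d] by (simp add: L_def mult.commute)
  qed
qed

theorem theorem1p1:
  fixes \<alpha> :: "(real ^ 'n) set \<Rightarrow> real"
  assumes "cone_angle \<alpha>"
  shows "(\<forall>P :: (real ^ 'n) set. full_dim_polytope P \<longrightarrow>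
            (\<Sum>i<CARD('n). (-1) ^ i * angle_sum \<alpha> i P) = (-1) ^ (CARD('n) + 1)) \<and>
         (\<forall>(l :: nat \<Rightarrow> real) (c :: real).
            (\<forall>P :: (real ^ 'n) set. full_dim_polytope P \<longrightarrow>
               (\<Sum>i<CARD('n). l i * angle_sum \<alpha> i P) = c) \<longrightarrow>
            (\<exists>t :: real. (\<forall>i<CARD('n). l i = t * (-1) ^ i) \<and> c = t * (-1) ^ (CARD('n) + 1)))"
  using gram_relation[OF assms] gram_relation_unique[OF assms] by (simp only: DIM_cart DIM_real mult_1_right) blast

end
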